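(* Let $w\in S_n$, and let $\Delta(Q_{n\times n},w)$ be the square subword complex. Then the double Grothendieck polynomial satisfies $$\mathcal G_w(\mathbf x,\mathbf y)=\sum_{\text{facets } Q_{n\times n}\smallsetminus D}\ \ \prod_{(i,j)\in D}(1-x_iy_j)\prod_{(i,j)\in\mathrm{abs}(D)}x_iy_j,$$ and the (single) Grothendieck polynomial satisfies $$\mathcal G_w(\mathbf x)=\sum_{\text{facets } Q_{n\times n}\smallsetminus D}(\mathbf 1-\mathbf x)^D\,\mathbf x^{\mathrm{abs}(D)},$$ where both sums are over the facets $Q_{n\times n}\smallsetminus D$ of $\Delta(Q_{n\times n},w)$, $(\mathbf 1-\mathbf x)^D=\prod_{(i,j)\in D}(1-x_i)$ and $\mathbf x^{\mathrm{abs}(D)}=\prod_{(i,j)\in\mathrm{abs}(D)}x_i$.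
   Context: Grothendieck polynomials: let $s_i$ be the adjacent transposition switching $i$ and $i+1$, and let $S_n$ act on polynomials in $x_1,\ldots,x_n$ by permuting these variables. The Demazure operator $\overline\partial_i$ ($1\le i\le n-1$) is $\overline\partial_i(f)=\dfrac{x_{i+1}f-x_i(s_i\cdot f)}{x_{i+1}-x_i}$; it acts on the $x$ variables only, any $y$ variables being treated as coefficients. Let $w_0\in S_n$ be the longest permutation. The Grothendieck polynomials $\mathcal G_w(\mathbf x)$, $w\in S_n$, are defined by $\mathcal G_{w_0}(\mathbf x)=\prod_{i=1}^n(1-x_i)^{n-i}$ and the recurrence $\mathcal G_{ws_i}(\mathbf x)=\overline\partial_i\,\mathcal G_w(\mathbf x)$ whenever $\mathrm{length}(ws_i)<\mathrm{length}(w)$. The double Grothendieck polynomials $\mathcal G_w(\mathbf x,\mathbf y)$ are defined by the same recurrence starting from $\mathcal G_{w_0}(\mathbf x,\mathbf y)=\prod_{i+j\le n}(1-x_iy_j)$. Words and subword complexes: let $\Pi=S_{2n}$ with simple reflections $\Sigma=\{s_1,\ldots,s_{2n-1}\}$; $S_n$ is viewed inside $S_{2n}$ as usual. A word is an ordered sequence $Q=(\sigma_1,\ldots,\sigma_m)$ of elements of $\Sigma$. A subword is an ordered subsequence remembered with its positions, i.e. a subset of the positions of $Q$; set operations on subwords are performed on positions. $P$ represents $\pi\in\Pi$ if the ordered product of the letters of $P$ is a reduced decomposition of $\pi$; $P$ contains $\pi$ if some subsequence of $P$ represents $\pi$; a subword is reduced if it represents some element. The subword complex $\Delta(Q,\pi)$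 is the simplicial complex whose faces are the subwords $Q\smallsetminus P$ such that $P$ contains $\pi$; its facets are the $Q\smallsetminus D$ with $D$ representing $\pi$. Square word: $Q_{n\times n}$ is the word of size $n^2$ $$s_ns_{n-1}\cdots s_2s_1\ \ s_{n+1}s_n\cdots s_3s_2\ \ \cdots\ \ s_{2n-1}s_{2n-2}\cdots s_{n+1}s_n.$$ Its letters fill the $n\times n$ grid by reading each row from right to left, rows from top to bottom; thus the letter at position (row $i$, column $j$) is $s_{i+j-1}$. Subwords of $Q_{n\times n}$ are regarded as subsets of the $n\times n$ grid, with elements $(i,j)$ where $(1,1)$ is the upper-left and $(1,n)$ the upper-right position. The complex $\Delta(Q_{n\times n},w)$ is called the square subword complex. Demazure product: for $\tau\in\Pi$ and $\sigma\in\Sigma$ put $\tau*\sigma=\tau\sigma$ if $\mathrm{length}(\tau\sigma)>\mathrm{length}(\tau)$ and $\tau*\sigma=\tau$ otherwise. The Demazure product of a word $P=(\tau_1,\ldots,\tau_k)$ is $\delta(P)=(\cdots((1*\tau_1)*\tau_2)\cdots)*\tau_k$. Absorbable reflections: given a reduced subword $D$ of $Q=(\sigma_1,\ldots,\sigma_m)$, a reflection $\sigma_k\in Q\smallsetminus D$ is absorbable if $T=D\cup\sigma_k$ satisfies: (i) $\delta(T)=\delta(D)$, and (ii) the unique reflection $\sigma_l\in D$ with $\delta(T\smallsetminus\sigma_l)=\delta(D)$ has index $l<k$ in the word $Q$. (When (i) holds, such a $\sigma_l\in D$ exists and is unique.) $\mathrm{abs}(D)$ is the set of (positions of) absorbable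 reflections for $D$. *)

theory Defs
  imports
    "HOL-Library.Poly_Mapping"
    "HOL-Combinatorics.Permutations"
begin

subsection \<open>The symmetric group as a Coxeter group\<close>

text \<open>
  An element of \<open>S\<^sub>N\<close> is a function \<open>\<pi> :: nat \<Rightarrow> nat\<close> with \<open>\<pi> permutes {1..N}\<close>, so that
  \<open>S\<^sub>n\<close> is literally a subset of \<open>S\<^sub>N\<close> for \<open>n \<le> N\<close>. The product is composition of functions;
  in particular \<open>w s\<^sub>i\<close> is \<open>w \<circ> adj i\<close>.
\<close>

definition adj :: "nat \<Rightarrow> nat \<Rightarrow> nat" where
  "adj i = transpose i (Suc i)"

definition simple_reflections :: "nat \<Rightarrow> (nat \<Rightarrow> nat) set" where
  "simple_reflections N = adj ` {1..<N}"

type_synonym word = "(nat \<Rightarrow> nat) list"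

definition word_prod :: "word \<Rightarrow> nat \<Rightarrow> nat" where
  "word_prod Q = foldr (\<circ>) Q id"

definition perm_length :: "nat \<Rightarrow> (nat \<Rightarrow> nat) \<Rightarrow> nat" where
  "perm_length N \<pi> =
     (LEAST k. \<exists>Q. set Q \<subseteq> simple_reflections N \<and> length Q = k \<and> word_prod Q = \<pi>)"

definition longest_perm :: "nat \<Rightarrow> nat \<Rightarrow> nat" where
  "longest_perm n = (ARG_MAX (perm_length n) w. w permutes {1..n})"


subsection \<open>Grothendieck polynomials\<close>

text \<open>
  Polynomials over \<open>'a\<close> in variables \<open>x\<^sub>0, x\<^sub>1, x\<^sub>2, \<dots>\<close>, as finitely supported functions from
  exponent vectors to coefficients. The variable \<open>x\<^sub>0\<close> is never used. Single Grothendieck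
  polynomials live in \<open>int mpoly\<close>, double ones in \<open>int mpoly mpoly\<close>: the outer variables are
  the \<open>x\<^sub>i\<close> and the inner ones, which are coefficients, are the \<open>y\<^sub>j\<close>.
\<close>

type_synonym 'a mpoly = "(nat \<Rightarrow>\<^sub>0 nat) \<Rightarrow>\<^sub>0 'a"

definition X :: "nat \<Rightarrow> 'a::comm_ring_1 mpoly" where
  "X i = Poly_Mapping.single (Poly_Mapping.single i 1) 1"

definition Y :: "nat \<Rightarrow> 'a::comm_ring_1 mpoly mpoly" where
  "Y j = Poly_Mapping.single 0 (X j)"

text \<open>
  The inner \<open>map_key \<pi>\<close> sends an exponent vector \<open>m\<close> to \<open>m \<circ> \<pi>\<close>, so the coefficient of
  \<open>permute_vars \<pi> f\<close> at \<open>m\<close> is that of \<open>f\<close> at \<open>m \<circ> \<pi>\<close>; this is the action with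
  \<open>\<pi> \<cdot> x\<^sub>i = x\<^bsub>\<pi>(i)\<^esub>\<close>, see \<open>permute_vars_X\<close>.
\<close>

definition permute_vars :: "(nat \<Rightarrow> nat) \<Rightarrow> 'a::comm_ring_1 mpoly \<Rightarrow> 'a mpoly" where
  "permute_vars \<pi> f = Poly_Mapping.map_key (Poly_Mapping.map_key \<pi>) f"

lemma inj_map_key:
  assumes "bij \<pi>"
  shows "inj (Poly_Mapping.map_key \<pi> :: (nat \<Rightarrow>\<^sub>0 nat) \<Rightarrow> nat \<Rightarrow>\<^sub>0 nat)"
proof (rule injI, rule poly_mapping_eqI)
  fix m m' :: "nat \<Rightarrow>\<^sub>0 nat" and k
  assume *: "Poly_Mapping.map_key \<pi> m = Poly_Mapping.map_key \<pi> m'"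
  obtain j where k: "k = \<pi> j"
    using assms by (metis bij_pointE)
  show "Poly_Mapping.lookup m k = Poly_Mapping.lookup m' k"
    using arg_cong[OF *, of "\<lambda>p. Poly_Mapping.lookup p j"] bij_is_inj[OF assms]
    by (simp add: map_key.rep_eq k)
qed

lemma permute_vars_X:
  assumes "bij \<pi>"
  shows "permute_vars \<pi> (X i) = (X (\<pi> i) :: 'a::comm_ring_1 mpoly)"
proof -
  have "Poly_Mapping.map_key \<pi> (Poly_Mapping.single (\<pi> i) (1::nat)) = Poly_Mapping.single i 1"
    by (rule map_key_single[OF bij_is_inj[OF assms]])
  then show ?thesis
    unfolding permute_vars_def X_def
    by (metis map_key_single[OF inj_map_key[OF assms]])
qed

text \<open>The exact quotient of \<open>x\<^bsub>i+1\<^esub> f - x\<^sub>i (s\<^sub>i \<cdot> f)\<close> by \<open>x\<^bsub>i+1\<^esub> - x\<^sub>i\<close> in the polynomial ring.\<close>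

definition demazure_op :: "nat \<Rightarrow> 'a::comm_ring_1 mpoly \<Rightarrow> 'a mpoly" where
  "demazure_op i f =
     (THE g. (X (Suc i) - X i) * g = X (Suc i) * f - X i * permute_vars (adj i) f)"

text \<open>
  The polynomials assigned to \<open>w\<close> by the recurrence started from the polynomial \<open>g0\<close> at the
  longest permutation. That there is exactly one for each \<open>w \<in> S\<^sub>n\<close> is not built in.
\<close>

inductive groth_rel :: "nat \<Rightarrow> 'a::comm_ring_1 mpoly \<Rightarrow> (nat \<Rightarrow> nat) \<Rightarrow> 'a mpoly \<Rightarrow> bool"
  for n :: nat and g0 :: "'a mpoly" where
  longest: "groth_rel n g0 (longest_perm n) g0"
| descend: "groth_rel n g0 w f \<Longrightarrow> i \<in> {1..<n} \<Longrightarrow>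
    perm_length n (w \<circ> adj i) < perm_length n w \<Longrightarrow>
    groth_rel n g0 (w \<circ> adj i) (demazure_op i f)"

definition grothendieck :: "nat \<Rightarrow> (nat \<Rightarrow> nat) \<Rightarrow> int mpoly" where
  "grothendieck n w = (THE f. groth_rel n (\<Prod>i=1..n. (1 - X i) ^ (n - i)) w f)"

definition double_grothendieck :: "nat \<Rightarrow> (nat \<Rightarrow> nat) \<Rightarrow> int mpoly mpoly" where
  "double_grothendieck n w =
     (THE f. groth_rel n (\<Prod>(i, j)\<in>{(i, j). 1 \<le> i \<and> 1 \<le> j \<and> i + j \<le> n}. 1 - X i * Y j) w f)"


subsection \<open>Subword complexes\<close>

text \<open>
  A subword of \<open>Q\<close> is a set of positions, i.e. a subset of \<open>{..<length Q}\<close>; its sequence of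
  letters is \<open>nths Q P\<close>. The parameter \<open>N\<close> says that the ambient Coxeter group is \<open>S\<^sub>N\<close>.
\<close>

definition positions :: "word \<Rightarrow> nat set" where
  "positions Q = {..<length Q}"

definition represents :: "nat \<Rightarrow> word \<Rightarrow> nat set \<Rightarrow> (nat \<Rightarrow> nat) \<Rightarrow> bool" where
  "represents N Q P \<pi> \<longleftrightarrow>
     word_prod (nths Q P) = \<pi> \<and> length (nths Q P) = perm_length N \<pi>"

definition contains_perm :: "nat \<Rightarrow> word \<Rightarrow> nat set \<Rightarrow> (nat \<Rightarrow> nat) \<Rightarrow> bool" where
  "contains_perm N Q P \<pi> \<longleftrightarrow> (\<exists>R\<subseteq>P. represents N Q R \<pi>)"

definition subword_complex :: "nat \<Rightarrow> word \<Rightarrow> (nat \<Rightarrow> nat) \<Rightarrow> nat set set" where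
  "subword_complex N Q \<pi> = {positions Q - P | P. P \<subseteq> positions Q \<and> contains_perm N Q P \<pi>}"

definition facets :: "'a set set \<Rightarrow> 'a set set" where
  "facets \<Delta> = {F \<in> \<Delta>. \<forall>G\<in>\<Delta>. F \<subseteq> G \<longrightarrow> G = F}"


subsection \<open>Demazure products and absorbable reflections\<close>

definition demazure_mult :: "nat \<Rightarrow> (nat \<Rightarrow> nat) \<Rightarrow> (nat \<Rightarrow> nat) \<Rightarrow> nat \<Rightarrow> nat" where
  "demazure_mult N \<tau> \<sigma> = (if perm_length N (\<tau> \<circ> \<sigma>) > perm_length N \<tau> then \<tau> \<circ> \<sigma> else \<tau>)"

definition demazure_prod :: "nat \<Rightarrow> word \<Rightarrow> nat \<Rightarrow> nat" where
  "demazure_prod N P = foldl (demazure_mult N) id P"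

text \<open>Only meaningful when the subword \<open>D\<close> is reduced: then the \<open>l\<close> below exists and is unique.\<close>

definition absorbable :: "nat \<Rightarrow> word \<Rightarrow> nat set \<Rightarrow> nat set" where
  "absorbable N Q D =
     {k \<in> positions Q - D.
        let \<delta> = (\<lambda>P. demazure_prod N (nths Q P)); T = insert k D in
        \<delta> T = \<delta> D \<and> (THE l. l \<in> D \<and> \<delta> (T - {l}) = \<delta> D) < k}"


subsection \<open>The square word\<close>

text \<open>
  The cells of the \<open>n \<times> n\<close> grid, as pairs (row, column) indexed from 1, in the reading order:
  rows from top to bottom, each row from right to left.
\<close>

definition grid :: "nat \<Rightarrow> (nat \<times> nat) list" where
  "grid n = [(i, j). i \<leftarrow> [1..<Suc n], j \<leftarrow> rev [1..<Suc n]]"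

definition square_word :: "nat \<Rightarrow> word" where
  "square_word n = map (\<lambda>(i, j). adj (i + j - 1)) (grid n)"

definition cells :: "nat \<Rightarrow> nat set \<Rightarrow> (nat \<times> nat) set" where
  "cells n P = (\<lambda>k. grid n ! k) ` P"

definition square_complex :: "nat \<Rightarrow> (nat \<Rightarrow> nat) \<Rightarrow> nat set set" where
  "square_complex n w = subword_complex (2 * n) (square_word n) w"

definition square_absorbable :: "nat \<Rightarrow> nat set \<Rightarrow> nat set" where
  "square_absorbable n D = absorbable (2 * n) (square_word n) D"

end

theory Submission
  imports Defs
begin

text \<open>
  Read the square word from left to right and record the product \<open>\<tau>\<close> of the letters chosen for a
  reduced subword \<open>D\<close> so far. A letter \<open>s\<^sub>j\<close> may be chosen only if \<open>\<tau>\<close> has no descent at \<open>j\<close>, because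
  \<open>D\<close> has to stay reduced; and, by the exchange property, a position that is not chosen is absorbable
  exactly if \<open>\<tau>\<close> does have a descent at \<open>j\<close> (\<open>absorbable_eq_absorbed\<close>). Hence, if a cell has weight
  \<open>p = x\<^sub>i y\<^sub>j\<close>, passing its letter multiplies the weight by \<open>1 - p\<close> and \<open>\<tau>\<close> by the letter, or leaves both
  unchanged, when \<open>\<tau>\<close> has an ascent; and it multiplies the weight by \<open>p\<close> when \<open>\<tau>\<close> has a descent. This is
  right multiplication by \<open>1 + (1 - p) u\<^sub>j\<close> in the 0-Hecke algebra, whose generators satisfy
  \<open>u\<^sub>j u\<^sub>j = - u\<^sub>j\<close> and the braid relations. So the sum over the facets is the coefficient of \<open>w\<close> in the
  product of these factors over the square word (\<open>transfer_eq_sum_reduced_subwords\<close>), a form of the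
  generating function of Fomin and Kirillov.

  That these coefficients obey the recurrence follows from the Yang-Baxter equation
  (\<open>hecke_op_yang_baxter\<close>). A factor for \<open>s\<^sub>i\<close> with parameter \<open>x\<^bsub>i+1\<^esub> / x\<^sub>i\<close>, multiplied on the right, passes
  through rows \<open>i\<close> and \<open>i + 1\<close>, interchanging \<open>x\<^sub>i\<close> and \<open>x\<^bsub>i+1\<^esub>\<close> there, and comes out on the left as a factor for
  \<open>s\<^bsub>i+n\<^esub>\<close>. The latter does not affect coefficients of elements of \<open>S\<^sub>n\<close>. Comparing
  coefficients, with denominators cleared, gives
  \<open>x\<^bsub>i+1\<^esub> F(w) + (x\<^sub>i - x\<^bsub>i+1\<^esub>) F(w s\<^sub>i) = x\<^sub>i (s\<^sub>i \<cdot> F(w))\<close> at a descent \<open>i\<close> of \<open>w\<close>, which is the defining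
  equation of the Demazure operator (\<open>demazure_op_groth_poly\<close>).

  At the longest permutation only the letters \<open>s\<^sub>j\<close> with \<open>j < n\<close> matter. They form the staircase
  \<open>i + j \<le> n\<close>, which is itself a reduced word, so there is a single summand
  (\<open>transfer_rows_reversal\<close>). Every \<open>w\<close> in \<open>S\<^sub>n\<close> is reached from the longest permutation, and every value
  that the recurrence assigns to \<open>w\<close> is the coefficient at \<open>w\<close>; so the recurrence is well defined and the
  theorem follows. The second set of variables enters only through elements \<open>c\<^sub>j\<close> of the coefficient
  ring: \<open>c\<^sub>j = y\<^sub>j\<close> gives the double polynomials and \<open>c\<^sub>j = 1\<close> the single ones.
\<close>

section \<open>Permuting variables is a ring homomorphism\<close>

lemma mpoly_induct [case_names zero monom_add]:
  fixes p :: "'a::comm_monoid_add mpoly"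
  assumes "P 0" and "\<And>m c q. P q \<Longrightarrow> P (Poly_Mapping.single m c + q)"
  shows "P p"
proof (induction p rule: Poly_Mapping.update_induct)
  case const
  show ?case by (rule assms(1))
next
  case (update f m c)
  have "Poly_Mapping.update m c f = Poly_Mapping.single m c + f"
    using update(1)
    by (intro poly_mapping_eqI) (auto simp: lookup_add lookup_single update.rep_eq when_def in_keys_iff)
  then show ?case
    using assms(2)[OF update(3)] by simp
qed

context
  fixes \<pi> :: "nat \<Rightarrow> nat"
  assumes bij: "bij \<pi>"
begin

lemma permute_vars_add: "permute_vars \<pi> (f + g) = permute_vars \<pi> f + permute_vars \<pi> g"
  unfolding permute_vars_def by (rule map_key_plus[OF inj_map_key[OF bij]])

lemma permute_vars_monom:
  fixes c :: "'a::comm_ring_1"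
  shows "permute_vars \<pi> (Poly_Mapping.single m c)
    = Poly_Mapping.single (Poly_Mapping.map_key (inv \<pi>) m) c"
proof -
  have "Poly_Mapping.map_key \<pi> (Poly_Mapping.map_key (inv \<pi>) m) = m"
    using bij by (simp add: map_key_compose bij_is_inj bij_imp_bij_inv map_key_id inv_o_cancel
        flip: id_def)
      (simp add: id_def map_key_id)
  then show ?thesis
    unfolding permute_vars_def
    by (metis map_key_single[OF inj_map_key[OF bij]])
qed

lemma permute_vars_zero: "permute_vars \<pi> 0 = 0"
  by (simp add: permute_vars_def inj_map_key[OF bij])

lemma permute_vars_mult: "permute_vars \<pi> (f * g) = permute_vars \<pi> f * permute_vars \<pi> g"
proof (induction f rule: mpoly_induct)
  case zero
  then show ?case by (simp add: permute_vars_zero)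
next
  case (monom_add m c f)
  have "permute_vars \<pi> (Poly_Mapping.single m c * g)
      = permute_vars \<pi> (Poly_Mapping.single m c) * permute_vars \<pi> g"
  proof (induction g rule: mpoly_induct)
    case zero
    then show ?case by (simp add: permute_vars_zero)
  next
    case (monom_add m' c' g)
    have "inj (inv \<pi>)"
      by (simp add: bij bij_imp_bij_inv bij_is_inj)
    then show ?case
      using monom_add by (simp add: permute_vars_add permute_vars_monom distrib_left mult_single map_key_plus)
  qed
  with monom_add show ?case
    by (simp add: permute_vars_add distrib_right)
qed

lemma permute_vars_coeff: "permute_vars \<pi> (Poly_Mapping.single 0 c) = Poly_Mapping.single 0 c"
  by (simp add: permute_vars_monom bij bij_imp_bij_inv bij_is_inj)

lemma permute_vars_one: "permute_vars \<pi> 1 = 1"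
  using permute_vars_coeff[of 1] by simp

lemma permute_vars_diff: "permute_vars \<pi> (f - g) = permute_vars \<pi> f - permute_vars \<pi> g"
  using permute_vars_add[of "f - g" g] by (simp add: algebra_simps)

end

lemma X_eq_iff: "(X i :: 'a::comm_ring_1 mpoly) = X j \<longleftrightarrow> i = j"
  unfolding X_def
  by (metis zero_neq_one lookup_single_eq lookup_single_not_eq)

text \<open>
  The polynomial ring over an integral domain is again an integral domain, so the quotient by
  \<open>x\<^bsub>i+1\<^esub> - x\<^sub>i\<close> is determined by the equation that defines it.
\<close>

lemma demazure_op_eqI:
  fixes f g :: "'a::idom mpoly"
  assumes "(X (Suc i) - X i) * g = X (Suc i) * f - X i * permute_vars (adj i) f"
  shows "demazure_op i f = g"
  unfolding demazure_op_def
proof (rule the_equality)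
  show "(X (Suc i) - X i) * g = X (Suc i) * f - X i * permute_vars (adj i) f"
    by (rule assms)
next
  fix h
  assume "(X (Suc i) - X i) * h = X (Suc i) * f - X i * permute_vars (adj i) f"
  with assms have "(X (Suc i) - X i) * (h - g) = 0"
    by (simp add: right_diff_distrib)
  moreover have "X (Suc i) - X i \<noteq> (0 :: 'a mpoly)"
    by (simp add: X_eq_iff)
  ultimately show "h = g" by simp
qed

section \<open>Descents, inversions and length\<close>

lemma adj_simps [simp]: "adj j j = Suc j" "adj j (Suc j) = j"
  "k \<noteq> j \<Longrightarrow> k \<noteq> Suc j \<Longrightarrow> adj j k = k"
  by (simp_all add: adj_def transpose_def)

lemma adj_adj [simp]: "adj j \<circ> adj j = id" "v \<circ> adj j \<circ> adj j = v" "adj j (adj j k) = k"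
  by (simp_all add: adj_def comp_assoc)

lemma adj_commute:
  assumes "Suc j < k"
  shows "v \<circ> adj j \<circ> adj k = v \<circ> adj k \<circ> adj j"
  using assms by (auto simp: fun_eq_iff adj_def transpose_def)

lemma adj_braid: "v \<circ> adj (Suc j) \<circ> adj j \<circ> adj (Suc j) = v \<circ> adj j \<circ> adj (Suc j) \<circ> adj j"
  by (auto simp: fun_eq_iff adj_def transpose_def)

lemma bij_adj: "bij (adj i)"
  by (simp add: adj_def)

lemma adj_permutes: "i \<in> {1..<N} \<Longrightarrow> adj i permutes {1..N}"
  unfolding adj_def by (rule permutes_swap_id) auto

lemma permutes_comp_adj: "v permutes {1..N} \<Longrightarrow> i \<in> {1..<N} \<Longrightarrow> v \<circ> adj i permutes {1..N}"
  by (rule permutes_compose[OF adj_permutes])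

definition inversions :: "nat \<Rightarrow> (nat \<Rightarrow> nat) \<Rightarrow> (nat \<times> nat) set" where
  "inversions N v = {(a, b). 1 \<le> a \<and> a < b \<and> b \<le> N \<and> v b < v a}"

lemma finite_inversions: "finite (inversions N v)"
  by (rule finite_subset[of _ "{1..N} \<times> {1..N}"]) (auto simp: inversions_def)

lemma inversions_id: "inversions N id = {}"
  by (auto simp: inversions_def)

text \<open>
  Exchanging adjacent entries preserves the relative order of all other pairs of entries; only the pair
  at the positions \<open>i\<close> and \<open>i + 1\<close> itself becomes an inversion.
\<close>

lemma card_inversions_ascent:
  assumes "i \<in> {1..<N}" "v i < v (Suc i)"
  shows "card (inversions N (v \<circ> adj i)) = Suc (card (inversions N v))"
proof -
  let ?s = "map_prod (adj i) (adj i)"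
  have inj: "inj ?s"
    by (simp add: prod.inj_map bij_is_inj bij_adj)
  have s: "?s (?s p) = p" for p
    by (cases p) simp
  have moves: "adj i a < adj i b \<and> 1 \<le> adj i a \<and> adj i b \<le> N"
    if "1 \<le> a" "a < b" "b \<le> N" "(a, b) \<noteq> (i, Suc i)" for a b
    using that assms(1) by (auto simp: adj_def transpose_def)
  have "inversions N (v \<circ> adj i) = insert (i, Suc i) (?s ` inversions N v)"
  proof (intro equalityI subsetI)
    fix p assume p: "p \<in> inversions N (v \<circ> adj i)"
    show "p \<in> insert (i, Suc i) (?s ` inversions N v)"
    proof (cases "p = (i, Suc i)")
      case False
      obtain a b where ab: "p = (a, b)" by (cases p)
      have "?s p \<in> inversions N v"
        using p False moves[of a b] by (simp add: inversions_def ab)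
      then show ?thesis
        using s[of p] by (metis image_eqI insertI2)
    qed simp
  next
    fix p assume "p \<in> insert (i, Suc i) (?s ` inversions N v)"
    then show "p \<in> inversions N (v \<circ> adj i)"
    proof
      assume "p = (i, Suc i)"
      then show ?thesis using assms by (simp add: inversions_def)
    next
      assume "p \<in> ?s ` inversions N v"
      then obtain a b where ab: "p = ?s (a, b)" "(a, b) \<in> inversions N v" by auto
      then have "(a, b) \<noteq> (i, Suc i)"
        using assms by (auto simp: inversions_def)
      then show ?thesis
        using ab moves[of a b] by (simp add: inversions_def)
    qed
  qed
  moreover have "(i, Suc i) \<notin> ?s ` inversions N v"
  proof
    assume "(i, Suc i) \<in> ?s ` inversions N v"
    then have "?s (i, Suc i) \<in> inversions N v"
      using s by (metis imageE)
    then show False by (simp add: inversions_def)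
  qed
  ultimately show ?thesis
    using inj by (simp add: finite_inversions card_image inj_on_subset)
qed

lemma card_inversions_descent:
  assumes "i \<in> {1..<N}" "v (Suc i) < v i"
  shows "card (inversions N v) = Suc (card (inversions N (v \<circ> adj i)))"
  using card_inversions_ascent[of i N "v \<circ> adj i"] assms by simp

text \<open>
  Applied below to a permutation without descents and, after \<open>a \<mapsto> n + 1 - a\<close>, to one without ascents.
\<close>

lemma increasing_imp_identity:
  fixes f :: "nat \<Rightarrow> nat"
  assumes range: "\<And>a. a \<in> {1..n} \<Longrightarrow> f a \<in> {1..n}"
    and incr: "\<And>i. i \<in> {1..<n} \<Longrightarrow> f i < f (Suc i)"
    and a: "a \<in> {1..n}"
  shows "f a = a"
proof (rule antisym)
  have "1 \<le> a \<Longrightarrow> a \<le> n \<Longrightarrow> a \<le> f a" for a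
  proof (induction a rule: dec_induct)
    case base
    then show ?case using range[of 1] by simp
  next
    case (step m)
    then show ?case using incr[of m] by simp
  qed
  with a show "a \<le> f a" by simp
  have "a \<le> n \<Longrightarrow> 1 \<le> a \<Longrightarrow> f a \<le> a" for a
  proof (induction a rule: inc_induct)
    case base
    then show ?case using range[of n] by simp
  next
    case (step m)
    then show ?case using incr[of m] by simp
  qed
  with a show "f a \<le> a" by simp
qed

definition reversal :: "nat \<Rightarrow> nat \<Rightarrow> nat" where
  "reversal n a = (if a \<in> {1..n} then Suc n - a else a)"

lemma no_descent_imp_id:
  assumes v: "v permutes {1..n}" and asc: "\<And>i. i \<in> {1..<n} \<Longrightarrow> \<not> v (Suc i) < v i"
  shows "v = id"
proof
  fix a
  have "v i < v (Suc i)" if "i \<in> {1..<n}" for i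
    using asc[OF that] permutes_inj[OF v] by (metis injD linorder_neqE_nat n_not_Suc_n)
  then have "v a = a" if "a \<in> {1..n}"
    using increasing_imp_identity[of n v a] permutes_in_image[OF v] that by blast
  then show "v a = id a"
    using permutes_not_in[OF v] by (cases "a \<in> {1..n}") auto
qed

lemma no_ascent_imp_reversal:
  assumes v: "v permutes {1..n}" and desc: "\<And>i. i \<in> {1..<n} \<Longrightarrow> v (Suc i) < v i"
  shows "v = reversal n"
proof
  fix a
  show "v a = reversal n a"
  proof (cases "a \<in> {1..n}")
    case True
    have range: "v a \<in> {1..n}" if "a \<in> {1..n}" for a
      using permutes_in_image[OF v] that by blast
    have "Suc n - v a = a"
    proof (rule increasing_imp_identity[OF _ _ True])
      show "Suc n - v a \<in> {1..n}" if "a \<in> {1..n}" for a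
        using range[OF that] by auto
      show "Suc n - v i < Suc n - v (Suc i)" if "i \<in> {1..<n}" for i
        using desc[OF that] range[of i] that by auto
    qed
    then show ?thesis
      using True range[OF True] by (auto simp: reversal_def)
  next
    case False
    then show ?thesis
      using permutes_not_in[OF v] by (auto simp: reversal_def)
  qed
qed

lemma word_prod_append: "word_prod (P @ Q) = word_prod P \<circ> word_prod Q"
  by (induction P) (auto simp: word_prod_def)

definition letters_prod :: "nat list \<Rightarrow> nat \<Rightarrow> nat" where
  "letters_prod js = word_prod (map adj js)"

lemma letters_prod_simps [simp]:
  "letters_prod [] = id"
  "letters_prod (j # js) = adj j \<circ> letters_prod js"
  "letters_prod (js @ ks) = letters_prod js \<circ> letters_prod ks"
  by (simp_all add: letters_prod_def word_prod_append) (simp_all add: word_prod_def)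

lemma letters_prod_permutes: "set js \<subseteq> {1..<N} \<Longrightarrow> letters_prod js permutes {1..N}"
proof (induction js)
  case (Cons j js)
  then show ?case
    unfolding letters_prod_simps
    by (intro permutes_compose adj_permutes) auto
qed (simp only: letters_prod_simps permutes_id)

lemma card_inversions_le_length:
  "set js \<subseteq> {1..<N} \<Longrightarrow> card (inversions N (letters_prod js)) \<le> length js"
proof (induction js rule: rev_induct)
  case Nil
  then show ?case by (simp only: letters_prod_simps inversions_id) simp
next
  case (snoc j js)
  let ?v = "letters_prod js"
  have "inj ?v"
    using snoc.prems by (intro permutes_inj[OF letters_prod_permutes]) auto
  then have "?v j \<noteq> ?v (Suc j)"
    by (metis injD n_not_Suc_n)
  then have "card (inversions N (letters_prod js \<circ> adj j)) \<le> length (js @ [j])"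
    using snoc card_inversions_ascent[of j N ?v] card_inversions_descent[of j N ?v]
    by (cases "?v j < ?v (Suc j)") auto
  then show ?case
    by (simp only: letters_prod_simps comp_id)
qed

lemma reduced_word_exists:
  assumes "v permutes {1..N}"
  shows "\<exists>js. set js \<subseteq> {1..<N} \<and> length js = card (inversions N v) \<and> letters_prod js = v"
  using assms
proof (induction "card (inversions N v)" arbitrary: v rule: less_induct)
  case less
  show ?case
  proof (cases "\<exists>i\<in>{1..<N}. v (Suc i) < v i")
    case True
    then obtain i where i: "i \<in> {1..<N}" "v (Suc i) < v i" by blast
    note len = card_inversions_descent[OF i]
    have "v \<circ> adj i permutes {1..N}"
      using less.prems i(1) by (rule permutes_comp_adj)
    then obtain js where js: "set js \<subseteq> {1..<N}" "length js = card (inversions N (v \<circ> adj i))"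
      "letters_prod js = v \<circ> adj i"
      using less.hyps len by auto
    then show ?thesis
      using len i(1) by (intro exI[of _ "js @ [i]"]) auto
  next
    case False
    then have "v = id"
      using no_descent_imp_id[OF less.prems] by blast
    then show ?thesis
      by (intro exI[of _ "[]"]) (simp add: inversions_id)
  qed
qed

text \<open>
  The number of inversions does not refer to the ambient group, so lengths in \<open>S\<^sub>n\<close> and in \<open>S\<^bsub>2n\<^esub>\<close> agree, and the
  comparison of lengths becomes a comparison of neighbouring values
  (\<open>perm_length_less_iff_descent\<close>).
\<close>

lemma perm_length_eq_card_inversions:
  assumes "v permutes {1..N}"
  shows "perm_length N v = card (inversions N v)"
  unfolding perm_length_def
proof (rule Least_equality)
  obtain js where "set js \<subseteq> {1..<N}" "length js = card (inversions N v)" "letters_prod js = v"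
    using reduced_word_exists[OF assms] by blast
  then show "\<exists>Q. set Q \<subseteq> simple_reflections N \<and> length Q = card (inversions N v) \<and> word_prod Q = v"
    by (intro exI[of _ "map adj js"]) (auto simp: simple_reflections_def letters_prod_def)
next
  fix k
  assume "\<exists>Q. set Q \<subseteq> simple_reflections N \<and> length Q = k \<and> word_prod Q = v"
  then obtain Q where Q: "set Q \<subseteq> adj ` {1..<N}" "length Q = k" "word_prod Q = v"
    by (auto simp: simple_reflections_def)
  have "Q \<in> map adj ` lists {1..<N}"
    using Q(1) by (simp flip: lists_image) blast
  then have "\<exists>js. set js \<subseteq> {1..<N} \<and> Q = map adj js"
    by auto
  with Q show "card (inversions N v) \<le> k"
    using card_inversions_le_length by (auto simp: letters_prod_def)
qed

lemma perm_length_ascent: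
  assumes "v permutes {1..N}" "i \<in> {1..<N}" "v i < v (Suc i)"
  shows "perm_length N (v \<circ> adj i) = Suc (perm_length N v)"
  using assms card_inversions_ascent[of i N v]
  by (simp only: perm_length_eq_card_inversions permutes_comp_adj)

lemma perm_length_descent:
  assumes "v permutes {1..N}" "i \<in> {1..<N}" "v (Suc i) < v i"
  shows "perm_length N v = Suc (perm_length N (v \<circ> adj i))"
  using assms card_inversions_descent[of i N v]
  by (simp only: perm_length_eq_card_inversions permutes_comp_adj)

lemma permutes_adj_neq: "v permutes A \<Longrightarrow> v (Suc i) \<noteq> v i"
  by (metis permutes_inj injD n_not_Suc_n)

lemma perm_length_less_iff_descent:
  assumes "v permutes {1..N}" "i \<in> {1..<N}"
  shows "perm_length N (v \<circ> adj i) < perm_length N v \<longleftrightarrow> v (Suc i) < v i"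
  using perm_length_ascent[OF assms] perm_length_descent[OF assms] permutes_adj_neq[OF assms(1), of i]
  by (cases "v i < v (Suc i)") auto

lemma perm_length_le_length:
  "set js \<subseteq> {1..<N} \<Longrightarrow> perm_length N (letters_prod js) \<le> length js"
  using card_inversions_le_length letters_prod_permutes
  by (simp add: perm_length_eq_card_inversions)

text \<open>
  A permutation of maximal length has no ascent, as an ascent could be turned into a descent.
\<close>

lemma longest_perm_eq_reversal: "longest_perm n = reversal n"
proof (rule no_ascent_imp_reversal)
  have bound: "perm_length n v < Suc (n * n)" if "v permutes {1..n}" for v
  proof -
    have "card (inversions n v) \<le> card ({1..n} \<times> {1..n})"
      by (rule card_mono) (auto simp: inversions_def)
    with that show ?thesis
      by (simp add: perm_length_eq_card_inversions card_cartesian_product)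
  qed
  have "longest_perm n permutes {1..n} \<and>
      (\<forall>v. v permutes {1..n} \<longrightarrow> perm_length n v \<le> perm_length n (longest_perm n))"
    unfolding longest_perm_def
    using bound by (intro arg_max_nat_lemma[of _ id _ "Suc (n * n)"]) (auto simp: permutes_id)
  then have perm: "longest_perm n permutes {1..n}"
    and maximal: "v permutes {1..n} \<Longrightarrow> perm_length n v \<le> perm_length n (longest_perm n)" for v
    by auto
  show "longest_perm n permutes {1..n}" by (rule perm)
  show "longest_perm n (Suc i) < longest_perm n i" if "i \<in> {1..<n}" for i
    using perm_length_ascent[OF perm that] maximal[OF permutes_comp_adj[OF perm that]]
      permutes_adj_neq[OF perm, of i]
    by (cases "longest_perm n i < longest_perm n (Suc i)") auto
qed

section \<open>Reduced words and the exchange property\<close>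

lemma bij_letters_prod: "bij (letters_prod js)"
  by (induction js) (simp_all only: letters_prod_simps bij_id bij_comp bij_adj)

definition reduced :: "nat \<Rightarrow> nat list \<Rightarrow> bool" where
  "reduced N js \<longleftrightarrow> perm_length N (letters_prod js) = length js"

lemma perm_length_comp_le:
  assumes "v permutes {1..N}" "set js \<subseteq> {1..<N}"
  shows "perm_length N (v \<circ> letters_prod js) \<le> perm_length N v + length js"
proof -
  obtain ks where ks: "set ks \<subseteq> {1..<N}" "length ks = perm_length N v" "letters_prod ks = v"
    using reduced_word_exists[OF assms(1)] perm_length_eq_card_inversions[OF assms(1)] by auto
  then show ?thesis
    using perm_length_le_length[of "ks @ js" N] assms(2) by simp
qed

lemma reduced_prefix:
  assumes "set (js @ ks) \<subseteq> {1..<N}" "reduced N (js @ ks)"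
  shows "reduced N js"
  using assms perm_length_comp_le[of "letters_prod js" N ks] letters_prod_permutes[of js N]
    perm_length_le_length[of js N]
  by (simp add: reduced_def)

lemma reduced_snoc_iff:
  assumes "set (js @ [j]) \<subseteq> {1..<N}"
  shows "reduced N (js @ [j]) \<longleftrightarrow> reduced N js \<and> letters_prod js j < letters_prod js (Suc j)"
proof -
  have perm: "letters_prod js permutes {1..N}" and j: "j \<in> {1..<N}"
    using assms letters_prod_permutes by auto
  show ?thesis
    using reduced_prefix[OF assms] perm_length_ascent[OF perm j] perm_length_descent[OF perm j]
      permutes_adj_neq[OF perm, of j]
    by (cases "letters_prod js j < letters_prod js (Suc j)") (auto simp: reduced_def)
qed

text \<open>
  Apply the suffixes of the word, from right to left, to \<open>j\<close> and \<open>j + 1\<close>: their images start in increasing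
  and end in decreasing order, so some letter \<open>s\<^sub>b\<close> interchanges them. At that moment the images are \<open>b\<close> and
  \<open>b + 1\<close>, and the suffix after \<open>s\<^sub>b\<close> conjugates \<open>s\<^sub>j\<close> to \<open>s\<^sub>b\<close>.
\<close>

lemma exchange:
  assumes "letters_prod js (Suc j) < letters_prod js j"
  shows "\<exists>ks b ls. js = ks @ b # ls \<and> letters_prod js = letters_prod (ks @ ls @ [j])"
  using assms
proof (induction js)
  case (Cons a js)
  let ?v = "letters_prod js"
  show ?case
  proof (cases "?v (Suc j) < ?v j")
    case True
    then obtain ks b ls where "js = ks @ b # ls" "letters_prod js = letters_prod (ks @ ls @ [j])"
      using Cons.IH by blast
    then show ?thesis
      by (intro exI[of _ "a # ks"] exI[of _ b] exI[of _ ls]) (simp add: comp_assoc)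
  next
    case False
    have inj: "inj ?v"
      by (simp add: bij_letters_prod bij_is_inj)
    then have "?v j < ?v (Suc j)"
      using False by (metis injD linorder_neqE_nat n_not_Suc_n)
    then have a: "?v j = a" "?v (Suc j) = Suc a"
      using Cons.prems by (auto simp: adj_def transpose_def split: if_splits)
    have "adj a (?v x) = ?v (adj j x)" for x
      using a injD[OF inj, of x j] injD[OF inj, of x "Suc j"]
      by (cases "x = j"; cases "x = Suc j") (auto simp: adj_def transpose_def)
    then show ?thesis
      by (intro exI[of _ "[]"] exI[of _ a] exI[of _ js]) (auto simp: fun_eq_iff)
  qed
qed simp

section \<open>Demazure products\<close>

definition demazure_letters :: "nat \<Rightarrow> nat list \<Rightarrow> nat \<Rightarrow> nat" where
  "demazure_letters N js = demazure_prod N (map adj js)"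

lemma demazure_letters_cong_append:
  "demazure_letters N js = demazure_letters N js' \<Longrightarrow>
    demazure_letters N (js @ ks) = demazure_letters N (js' @ ks)"
  by (simp add: demazure_letters_def demazure_prod_def)

lemma demazure_letters_Nil: "demazure_letters N [] = id"
  by (simp add: demazure_letters_def demazure_prod_def)

lemma demazure_letters_snoc_raw: "demazure_letters N (js @ [j]) = demazure_mult N (demazure_letters N js) (adj j)"
  by (simp add: demazure_letters_def demazure_prod_def)

lemma demazure_letters_permutes: "set js \<subseteq> {1..<N} \<Longrightarrow> demazure_letters N js permutes {1..N}"
proof (induction js rule: rev_induct)
  case Nil
  then show ?case by (simp only: demazure_letters_Nil permutes_id)
next
  case (snoc j js)
  then show ?case
    unfolding demazure_letters_snoc_raw demazure_mult_def
    using permutes_comp_adj[of "demazure_letters N js" N j] by auto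
qed

lemma demazure_letters_snoc:
  assumes "set (js @ [j]) \<subseteq> {1..<N}"
  shows "demazure_letters N (js @ [j]) =
    (if demazure_letters N js (Suc j) < demazure_letters N js j then demazure_letters N js
     else demazure_letters N js \<circ> adj j)"
proof -
  have "demazure_letters N js permutes {1..N}" "j \<in> {1..<N}"
    using assms demazure_letters_permutes[of js N] by auto
  then show ?thesis
    using perm_length_ascent perm_length_descent permutes_adj_neq[of "demazure_letters N js" "{1..N}" j]
    by (cases "demazure_letters N js j < demazure_letters N js (Suc j)")
      (auto simp: demazure_letters_snoc_raw demazure_mult_def)
qed

lemma reduced_imp_demazure_letters:
  "set js \<subseteq> {1..<N} \<Longrightarrow> reduced N js \<Longrightarrow> demazure_letters N js = letters_prod js"
proof (induction js rule: rev_induct)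
  case Nil
  then show ?case by (simp add: demazure_letters_Nil)
next
  case (snoc j js)
  have "reduced N js" "letters_prod js j < letters_prod js (Suc j)"
    using reduced_snoc_iff[OF snoc.prems(1)] snoc.prems(2) by auto
  with snoc.IH snoc.prems(1) have "demazure_letters N js = letters_prod js" by simp
  then show ?case
    using demazure_letters_snoc[OF snoc.prems(1)] \<open>letters_prod js j < letters_prod js (Suc j)\<close> by simp
qed

lemma perm_length_demazure_letters_le:
  "set js \<subseteq> {1..<N} \<Longrightarrow> perm_length N (demazure_letters N js) \<le> length js"
proof (induction js rule: rev_induct)
  case Nil
  then show ?case using perm_length_le_length[of "[]" N] by (simp only: demazure_letters_Nil letters_prod_simps)
next
  case (snoc j js)
  then show ?case
    using demazure_letters_snoc[OF snoc.prems] perm_length_comp_le[of "demazure_letters N js" N "[j]"] demazure_letters_permutes[of js N]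
    by (auto split: if_splits)
qed

text \<open>
  Every letter raises the length by at most one, so none of them can have been idle.
\<close>

lemma demazure_letters_full_length_imp_prod:
  "set js \<subseteq> {1..<N} \<Longrightarrow> perm_length N (demazure_letters N js) = length js \<Longrightarrow>
    letters_prod js = demazure_letters N js"
proof (induction js rule: rev_induct)
  case Nil
  then show ?case by (simp add: demazure_letters_Nil)
next
  case (snoc j js)
  have js: "set js \<subseteq> {1..<N}"
    using snoc.prems(1) by simp
  note step = demazure_letters_snoc[OF snoc.prems(1)]
  have asc: "\<not> demazure_letters N js (Suc j) < demazure_letters N js j"
    using step snoc.prems(2) perm_length_demazure_letters_le[OF js] by auto
  have "perm_length N (demazure_letters N js \<circ> adj j) \<le> Suc (perm_length N (demazure_letters N js))"
    using perm_length_comp_le[of "demazure_letters N js" N "[j]"] demazure_letters_permutes[OF js] snoc.prems(1) by simp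
  then have "perm_length N (demazure_letters N js) = length js"
    using step asc snoc.prems(2) perm_length_demazure_letters_le[OF js] by (simp add: o_def)
  then show ?case
    using snoc.IH[OF js] step asc by simp
qed

text \<open>
  If the Demazure product is shorter than the word, some letter is absorbed by the Demazure product of the
  letters before it, and it can be deleted without changing the result. It lies in \<open>ks\<close>, because every letter
  of \<open>js\<close> raises the length.
\<close>

lemma idle_step:
  assumes "set (js @ ks) \<subseteq> {1..<N}" "perm_length N (demazure_letters N js) = length js"
    "perm_length N (demazure_letters N (js @ ks)) < length (js @ ks)"
  shows "\<exists>ks1 c ks2. ks = ks1 @ c # ks2 \<and> demazure_letters N (js @ ks1 @ ks2) = demazure_letters N (js @ ks)"
  using assms
proof (induction ks rule: rev_induct)
  case (snoc c ks)
  have step: "demazure_letters N (js @ ks @ [c]) = (if demazure_letters N (js @ ks) (Suc c) < demazure_letters N (js @ ks) c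
      then demazure_letters N (js @ ks) else demazure_letters N (js @ ks) \<circ> adj c)"
    using demazure_letters_snoc[of "js @ ks" c N] snoc.prems(1) by simp
  show ?case
  proof (cases "demazure_letters N (js @ ks) (Suc c) < demazure_letters N (js @ ks) c")
    case True
    then show ?thesis
      using step by (intro exI[of _ ks] exI[of _ c] exI[of _ "[]"]) simp
  next
    case False
    have perm: "demazure_letters N (js @ ks) permutes {1..N}" and c: "c \<in> {1..<N}"
      using snoc.prems(1) demazure_letters_permutes[of "js @ ks" N] by auto
    have "demazure_letters N (js @ ks) c < demazure_letters N (js @ ks) (Suc c)"
      using False permutes_adj_neq[OF perm, of c] by linarith
    then have "perm_length N (demazure_letters N (js @ ks)) < length (js @ ks)"
      using snoc.prems(3) step False perm_length_ascent[OF perm c] by (simp add: o_def)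
    then obtain ks1 d ks2 where "ks = ks1 @ d # ks2" "demazure_letters N (js @ ks1 @ ks2) = demazure_letters N (js @ ks)"
      using snoc.IH snoc.prems by auto
    then show ?thesis
      using demazure_letters_cong_append[of N "js @ ks1 @ ks2" "js @ ks" "[c]"]
      by (intro exI[of _ ks1] exI[of _ d] exI[of _ "ks2 @ [c]"]) simp
  qed
qed simp

section \<open>Reduced subwords and absorbable reflections\<close>

lemma nths_split_at:
  "k < length js \<Longrightarrow> nths js P =
     nths js (P \<inter> {..<k}) @ (if k \<in> P then [js ! k] else []) @ nths js (P \<inter> {k<..})"
proof (induction js arbitrary: k P)
  case (Cons x js)
  show ?case
  proof (cases k)
    case 0
    have "{j. Suc j \<in> P \<inter> {..<0}} = {}" "{j. Suc j \<in> P \<inter> {0<..}} = {j. Suc j \<in> P}" by auto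
    then show ?thesis
      using 0 by (simp add: nths_Cons)
  next
    case (Suc l)
    have "{j. Suc j \<in> P \<inter> {..<Suc l}} = {j. Suc j \<in> P} \<inter> {..<l}"
      "{j. Suc j \<in> P \<inter> {Suc l<..}} = {j. Suc j \<in> P} \<inter> {l<..}" by auto
    moreover have "l < length js" using Cons.prems Suc by simp
    ultimately show ?thesis
      using Cons.IH[of l "{j. Suc j \<in> P}"] Suc by (simp add: nths_Cons)
  qed
qed simp

lemma nths_eq_append_Cons:
  "nths js P = ks @ b # ls \<Longrightarrow>
     \<exists>l\<in>P. l < length js \<and> ks = nths js (P \<inter> {..<l}) \<and> ls = nths js (P \<inter> {l<..})"
proof (induction js arbitrary: P ks)
  case (Cons x js)
  let ?P = "{j. Suc j \<in> P}"
  have shift: "{j. Suc j \<in> P \<inter> {..<Suc l}} = ?P \<inter> {..<l}"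
    "{j. Suc j \<in> P \<inter> {Suc l<..}} = ?P \<inter> {l<..}" for l
    by auto
  have zero: "{j. Suc j \<in> P \<inter> {..<0}} = {}" "{j. Suc j \<in> P \<inter> {0<..}} = ?P"
    by auto
  show ?case
  proof (cases "0 \<in> P \<and> ks = []")
    case True
    then show ?thesis
      using Cons.prems by (intro bexI[of _ 0]) (auto simp: nths_Cons zero)
  next
    case False
    then obtain ks' where ks': "nths js ?P = ks' @ b # ls" "ks = (if 0 \<in> P then [x] else []) @ ks'"
      using Cons.prems by (cases ks) (auto simp: nths_Cons split: if_splits)
    then obtain l where "l \<in> ?P" "l < length js" "ks' = nths js (?P \<inter> {..<l})"
      "ls = nths js (?P \<inter> {l<..})"
      using Cons.IH by blast
    moreover have "nths (x # js) (P \<inter> {..<Suc l}) = (if 0 \<in> P then [x] else []) @ nths js (?P \<inter> {..<l})"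
      "nths (x # js) (P \<inter> {Suc l<..}) = nths js (?P \<inter> {l<..})" for l
      by (simp_all only: nths_Cons shift) simp_all
    ultimately show ?thesis
      using ks'(2) by (intro bexI[of _ "Suc l"]) simp_all
  qed
qed simp

lemma comp_left_cancel: "bij f \<Longrightarrow> f \<circ> g = f \<circ> h \<Longrightarrow> g = h"
  by (metis bij_is_inj comp_apply inj_eq ext)

lemma comp_right_cancel: "bij f \<Longrightarrow> g \<circ> f = h \<circ> f \<Longrightarrow> g = h"
  by (metis bij_is_surj surj_fun_eq UNIV_I comp_apply fun_eq_iff surjD)

text \<open>
  Equality of the first two products says that \<open>bs\<close> conjugates \<open>b\<close> to \<open>a\<close>, equality of the last two that \<open>cs\<close>
  conjugates \<open>c\<close> to \<open>b\<close>. Moving \<open>b\<close> across \<open>cs\<close> in the first product therefore makes it meet \<open>c\<close> and cancel.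
\<close>

lemma three_deletions_shorten:
  assumes w1: "letters_prod (as @ bs @ b # cs @ c # ds) = w"
    and w2: "letters_prod (as @ a # bs @ cs @ c # ds) = w"
    and w3: "letters_prod (as @ a # bs @ b # cs @ ds) = w"
  shows "letters_prod (as @ bs @ cs @ ds) = w"
proof -
  have "letters_prod as \<circ> ((letters_prod bs \<circ> adj b) \<circ> letters_prod (cs @ c # ds))
      = letters_prod as \<circ> ((adj a \<circ> letters_prod bs) \<circ> letters_prod (cs @ c # ds))"
    using w1 w2 by (simp add: comp_assoc)
  then have ab: "letters_prod bs \<circ> adj b = adj a \<circ> letters_prod bs"
    by (blast dest: comp_left_cancel[OF bij_letters_prod] comp_right_cancel[OF bij_letters_prod])
  have "letters_prod (as @ a # bs) \<circ> ((letters_prod cs \<circ> adj c) \<circ> letters_prod ds)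
      = letters_prod (as @ a # bs) \<circ> ((adj b \<circ> letters_prod cs) \<circ> letters_prod ds)"
    using w2 w3 by (simp add: comp_assoc)
  then have bc: "letters_prod cs \<circ> adj c = adj b \<circ> letters_prod cs"
    by (blast dest: comp_left_cancel[OF bij_letters_prod] comp_right_cancel[OF bij_letters_prod])
  have "w = letters_prod as \<circ> letters_prod bs \<circ> adj b \<circ> (letters_prod cs \<circ> adj c) \<circ> letters_prod ds"
    using w1 by (simp add: comp_assoc)
  also have "\<dots> = letters_prod (as @ bs @ cs @ ds)"
    unfolding bc by (simp add: comp_assoc fun_eq_iff)
  finally show ?thesis by simp
qed

lemma nths_map: "nths (map f js) P = map f (nths js P)"
  by (induction js arbitrary: P) (auto simp: nths_Cons)

lemma represents_iff:
  "represents N (map adj js) D w \<longleftrightarrow> letters_prod (nths js D) = w \<and> reduced N (nths js D)"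
  by (auto simp: represents_def nths_map letters_prod_def reduced_def)

lemma set_nths_letters: "set js \<subseteq> {1..<N} \<Longrightarrow> set (nths js P) \<subseteq> {1..<N}"
  by (rule subset_trans[OF set_nths_subset])

lemma length_nths_card: "P \<subseteq> {..<length js} \<Longrightarrow> length (nths js P) = card P"
proof -
  assume "P \<subseteq> {..<length js}"
  then have "{i. i < length js \<and> i \<in> P} = P" by auto
  then show ?thesis by (simp add: length_nths)
qed

text \<open>
  Otherwise \<open>three_deletions_shorten\<close> would write \<open>w\<close> as a product of fewer than \<open>length(w)\<close> letters.
\<close>

lemma not_three_deletions:
  assumes letters: "set js \<subseteq> {1..<N}" and sorted: "p < q" "q < r" "r < length js"
    and mem: "p \<in> T" "q \<in> T" "r \<in> T"
    and w: "\<And>s. s \<in> {p, q, r} \<Longrightarrow> letters_prod (nths js (T - {s})) = w"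
    and len: "length (nths js T) = Suc (perm_length N w)"
  shows False
proof -
  define as bs cs ds where "as = nths js (T \<inter> {..<p})" and "bs = nths js (T \<inter> {p<..<q})"
    and "cs = nths js (T \<inter> {q<..<r})" and "ds = nths js (T \<inter> {r<..})"
  have split: "nths js P = nths js (P \<inter> {..<p}) @ (if p \<in> P then [js ! p] else []) @
      nths js (P \<inter> {p<..<q}) @ (if q \<in> P then [js ! q] else []) @
      nths js (P \<inter> {q<..<r}) @ (if r \<in> P then [js ! r] else []) @ nths js (P \<inter> {r<..})" for P
  proof -
    have "P \<inter> {..<r} \<inter> {..<q} \<inter> {..<p} = P \<inter> {..<p}" "P \<inter> {..<r} \<inter> {..<q} \<inter> {p<..} = P \<inter> {p<..<q}"
      "P \<inter> {..<r} \<inter> {q<..} = P \<inter> {q<..<r}"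
      using sorted by auto
    then show ?thesis
      using nths_split_at[of r js P] nths_split_at[of q js "P \<inter> {..<r}"]
        nths_split_at[of p js "P \<inter> {..<r} \<inter> {..<q}"] sorted
      by simp
  qed
  have sets: "(T - {p}) \<inter> {..<p} = T \<inter> {..<p}" "(T - {p}) \<inter> {p<..<q} = T \<inter> {p<..<q}"
    "(T - {p}) \<inter> {q<..<r} = T \<inter> {q<..<r}" "(T - {p}) \<inter> {r<..} = T \<inter> {r<..}"
    "(T - {q}) \<inter> {..<p} = T \<inter> {..<p}" "(T - {q}) \<inter> {p<..<q} = T \<inter> {p<..<q}"
    "(T - {q}) \<inter> {q<..<r} = T \<inter> {q<..<r}" "(T - {q}) \<inter> {r<..} = T \<inter> {r<..}"
    "(T - {r}) \<inter> {..<p} = T \<inter> {..<p}" "(T - {r}) \<inter> {p<..<q} = T \<inter> {p<..<q}"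
    "(T - {r}) \<inter> {q<..<r} = T \<inter> {q<..<r}" "(T - {r}) \<inter> {r<..} = T \<inter> {r<..}"
    using sorted by auto
  note defs = as_def[symmetric] bs_def[symmetric] cs_def[symmetric] ds_def[symmetric]
  have "nths js (T - {p}) = as @ bs @ js ! q # cs @ js ! r # ds"
    using split[of "T - {p}"] mem sorted unfolding sets defs by simp
  moreover have "nths js (T - {q}) = as @ js ! p # bs @ cs @ js ! r # ds"
    using split[of "T - {q}"] mem sorted unfolding sets defs by simp
  moreover have "nths js (T - {r}) = as @ js ! p # bs @ js ! q # cs @ ds"
    using split[of "T - {r}"] mem sorted unfolding sets defs by simp
  ultimately have "letters_prod (as @ bs @ cs @ ds) = w"
    using w[of p] w[of q] w[of r]
    by (intro three_deletions_shorten[where a = "js ! p" and b = "js ! q" and c = "js ! r"]) simp_all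
  moreover have "set (as @ bs @ cs @ ds) \<subseteq> {1..<N}"
    using set_nths_letters[OF letters] unfolding as_def bs_def cs_def ds_def by simp
  ultimately have "perm_length N w \<le> length (as @ bs @ cs @ ds)"
    using perm_length_le_length by blast
  moreover have "nths js T = as @ js ! p # bs @ js ! q # cs @ js ! r # ds"
    using split[of T] mem unfolding defs by simp
  ultimately show False using len by simp
qed

text \<open>
  Uniqueness of the letter that a new letter replaces: if \<open>T\<close> arises from a reduced subword by adding
  position \<open>k\<close>, then deleting \<open>k\<close>, \<open>l\<close> and \<open>l'\<close> would be three deletions with the same product.
\<close>

lemma deletions_unique:
  assumes letters: "set js \<subseteq> {1..<N}" and T: "T \<subseteq> {..<length js}"
    and mem: "k \<in> T" "l \<in> T" "l' \<in> T" and neq: "k \<noteq> l" "k \<noteq> l'"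
    and w: "\<And>s. s \<in> {k, l, l'} \<Longrightarrow> letters_prod (nths js (T - {s})) = w"
    and len: "length (nths js T) = Suc (perm_length N w)"
  shows "l = l'"
proof (rule ccontr)
  assume "l \<noteq> l'"
  then have card: "card {k, l, l'} = 3"
    using neq by auto
  obtain p q r where pqr: "{p, q, r} = {k, l, l'}" "p < q" "q < r"
  proof -
    have "\<exists>p q r. {p, q, r} = {k, l, l'} \<and> p < q \<and> q < r"
      using neq \<open>l \<noteq> l'\<close>
      by (metis insert_commute linorder_neqE_nat)
    then show ?thesis using that by blast
  qed
  have "{p, q, r} \<subseteq> T"
    unfolding pqr(1) using mem by simp
  then have "p \<in> T" "q \<in> T" "r \<in> T"
    by simp_all
  then show False
    using not_three_deletions[OF letters pqr(2,3), of T w] T w len pqr(1) by auto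
qed

text \<open>
  A description of the absorbable reflections that avoids Demazure products and looks only at the letters
  before a position; see \<open>absorbable_eq_absorbed\<close>.
\<close>

definition absorbed :: "nat list \<Rightarrow> nat set \<Rightarrow> nat set" where
  "absorbed js D = {k \<in> {..<length js} - D.
     letters_prod (nths js (D \<inter> {..<k})) (Suc (js ! k)) < letters_prod (nths js (D \<inter> {..<k})) (js ! k)}"

text \<open>
  Let \<open>A\<close>, \<open>j\<close> and \<open>C\<close> be the letters of \<open>D\<close> before \<open>k\<close>, the letter at \<open>k\<close>, and the letters of \<open>D\<close> after \<open>k\<close>. If
  the product of \<open>A\<close> has a descent at \<open>j\<close>, then \<open>j\<close> is idle in the Demazure product, and the exchange property
  finds a letter of \<open>A\<close> that \<open>j\<close> can replace. If it has an ascent, then \<open>A\<close> followed by \<open>j\<close> is reduced; so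
  if the Demazure product of the enlarged subword is still that of \<open>D\<close>, the idle letter lies in \<open>C\<close>,
  to the right of \<open>k\<close>. In both cases \<open>deletions_unique\<close> identifies the letter found with the one in the
  definition of absorbable reflections.
\<close>

lemma absorbable_eq_absorbed:
  assumes letters: "set js \<subseteq> {1..<N}" and D: "D \<subseteq> {..<length js}"
    and red: "reduced N (nths js D)"
  shows "absorbable N (map adj js) D = absorbed js D"
proof -
  define w where "w = letters_prod (nths js D)"
  let ?d = "\<lambda>P. demazure_letters N (nths js P)"
  note let_nths = set_nths_letters[OF letters]
  have dD: "?d D = w"
    using reduced_imp_demazure_letters[OF let_nths red] w_def by simp
  have lw: "perm_length N w = length (nths js D)"
    using red by (simp add: reduced_def w_def)
  have main: "(?d (insert k D) = w \<and> (THE l. l \<in> D \<and> ?d (insert k D - {l}) = w) < k) \<longleftrightarrow>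
      letters_prod (nths js (D \<inter> {..<k})) (Suc (js ! k)) < letters_prod (nths js (D \<inter> {..<k})) (js ! k)"
    (is "_ \<longleftrightarrow> ?desc") if k: "k < length js" "k \<notin> D" for k
  proof -
    let ?T = "insert k D"
    let ?A = "nths js (D \<inter> {..<k})" and ?C = "nths js (D \<inter> {k<..})" and ?j = "js ! k"
    have TD: "?T - {k} = D" using k by auto
    have finD: "finite D" using D by (rule finite_subset) simp
    have T: "?T \<subseteq> {..<length js}" using D k by auto
    have int: "?T \<inter> {..<k} = D \<inter> {..<k}" "?T \<inter> {k<..} = D \<inter> {k<..}" by auto
    have nT: "nths js ?T = ?A @ [?j] @ ?C"
      using nths_split_at[OF k(1), of ?T] int by simp
    have nD: "nths js D = ?A @ ?C"
      using nths_split_at[OF k(1), of D] k(2) by simp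
    have redA: "reduced N ?A"
      using reduced_prefix[of ?A ?C N] let_nths red nD by simp
    have j: "?j \<in> {1..<N}" using letters nth_mem[OF k(1)] by blast
    have Aj: "set (?A @ [?j]) \<subseteq> {1..<N}" using let_nths[of "D \<inter> {..<k}"] j by simp
    have the_l: "(THE l. l \<in> D \<and> ?d (?T - {l}) = w) = l" if l: "l \<in> D" "?d (?T - {l}) = w" for l
    proof (rule the_equality)
      show "l \<in> D \<and> ?d (?T - {l}) = w" using l by simp
      have prod: "letters_prod (nths js (?T - {l})) = w" if l: "l \<in> D" "?d (?T - {l}) = w" for l
      proof -
        have "card (?T - {l}) = card D"
          using l(1) k(2) finD by (simp add: card_Diff_singleton)
        then have "length (nths js (?T - {l})) = perm_length N w"
          using T D lw by (simp add: length_nths_card subset_insertI2 Diff_subset[THEN subset_trans])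
        then show ?thesis
          using demazure_letters_full_length_imp_prod[OF let_nths[of "?T - {l}"]] l(2) by simp
      qed
      fix l' assume l': "l' \<in> D \<and> ?d (?T - {l'}) = w"
      show "l' = l"
      proof (rule deletions_unique[OF letters T, of k l' l w])
        show "length (nths js ?T) = Suc (perm_length N w)"
          using nT nD lw by simp
        show "letters_prod (nths js (?T - {s})) = w" if s: "s \<in> {k, l', l}" for s
        proof -
          consider "s = k" | "s \<in> {l, l'}" using s by blast
          then show ?thesis
          proof cases
            case 1
            then show ?thesis using TD w_def by simp
          next
            case 2
            then show ?thesis using prod[of s] l l' by blast
          qed
        qed
      qed (use l l' k(2) in auto)
    qed
    show ?thesis
    proof (cases ?desc)
      \<comment> \<open>the letter at \<open>k\<close> is idle after \<open>A\<close> and replaces an earlier letter\<close>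
      case True
      have dA: "demazure_letters N (?A @ [?j]) = demazure_letters N ?A" "demazure_letters N ?A = letters_prod ?A"
        using demazure_letters_snoc[OF Aj] reduced_imp_demazure_letters[OF let_nths redA] True by auto
      then have "?d ?T = w"
        using demazure_letters_cong_append[OF dA(1), of ?C] nT nD dD by simp
      obtain ks b ls where ex: "?A = ks @ b # ls" "letters_prod ?A = letters_prod (ks @ ls @ [?j])"
        using exchange[OF True] by blast
      then obtain l where l: "l \<in> D" "l < k" "ks = nths js (D \<inter> {..<k} \<inter> {..<l})"
        "ls = nths js (D \<inter> {..<k} \<inter> {l<..})"
        using nths_eq_append_Cons[OF ex(1)] by auto
      have "nths js (D \<inter> {..<k} - {l}) = ks @ ls"
      proof -
        have "(D \<inter> {..<k} - {l}) \<inter> {..<l} = D \<inter> {..<k} \<inter> {..<l}"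
          "(D \<inter> {..<k} - {l}) \<inter> {l<..} = D \<inter> {..<k} \<inter> {l<..}" by auto
        then show ?thesis
          using nths_split_at[of l js "D \<inter> {..<k} - {l}"] l k(1) by simp
      qed
      moreover have "(?T - {l}) \<inter> {..<k} = D \<inter> {..<k} - {l}" "(?T - {l}) \<inter> {k<..} = D \<inter> {k<..}"
        using l(2) by auto
      ultimately have "nths js (?T - {l}) = (ks @ ls @ [?j]) @ ?C"
        using nths_split_at[OF k(1), of "?T - {l}"] l(2) by simp
      moreover have "demazure_letters N (ks @ ls @ [?j]) = demazure_letters N ?A"
      proof -
        have "reduced N (ks @ ls @ [?j])"
          using redA ex unfolding reduced_def by simp
        moreover have "set (ks @ ls @ [?j]) \<subseteq> {1..<N}"
          using Aj ex(1) by auto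
        ultimately show ?thesis
          using reduced_imp_demazure_letters ex(2) dA(2) by metis
      qed
      ultimately have "?d (?T - {l}) = w"
        using demazure_letters_cong_append[of N "ks @ ls @ [?j]" ?A ?C] nD dD by simp
      then show ?thesis
        using the_l[OF l(1)] \<open>?d ?T = w\<close> l(2) True by simp
    next
      \<comment> \<open>the letters up to \<open>k\<close> stay reduced, so only a later letter can be idle\<close>
      case False
      have "\<not> (THE l. l \<in> D \<and> ?d (?T - {l}) = w) < k" if dT: "?d ?T = w"
      proof -
        have "letters_prod ?A ?j < letters_prod ?A (Suc ?j)"
          using False permutes_adj_neq[OF letters_prod_permutes[OF let_nths[of "D \<inter> {..<k}"]], of ?j]
          by linarith
        then have "reduced N (?A @ [?j])"
          using reduced_snoc_iff[OF Aj] redA by simp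
        then have "perm_length N (demazure_letters N (?A @ [?j])) = length (?A @ [?j])"
          using reduced_imp_demazure_letters[OF Aj] by (simp only: reduced_def)
        moreover have "set ((?A @ [?j]) @ ?C) \<subseteq> {1..<N}"
          using Aj let_nths[of "D \<inter> {k<..}"] by simp
        moreover have "perm_length N (demazure_letters N ((?A @ [?j]) @ ?C)) < length ((?A @ [?j]) @ ?C)"
          using dT lw nT nD by simp
        ultimately obtain ks c ls where idle: "?C = ks @ c # ls"
          "demazure_letters N ((?A @ [?j]) @ ks @ ls) = demazure_letters N ((?A @ [?j]) @ ?C)"
          using idle_step by blast
        then obtain l where l: "l \<in> D" "k < l" "l < length js" "ks = nths js (D \<inter> {k<..} \<inter> {..<l})"
          "ls = nths js (D \<inter> {k<..} \<inter> {l<..})"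
          using nths_eq_append_Cons[OF idle(1)] by auto
        have "nths js (D \<inter> {k<..} - {l}) = ks @ ls"
        proof -
          have "(D \<inter> {k<..} - {l}) \<inter> {..<l} = D \<inter> {k<..} \<inter> {..<l}"
            "(D \<inter> {k<..} - {l}) \<inter> {l<..} = D \<inter> {k<..} \<inter> {l<..}" by auto
          then show ?thesis
            using nths_split_at[of l js "D \<inter> {k<..} - {l}"] l k(1) by simp
        qed
        moreover have "(?T - {l}) \<inter> {..<k} = D \<inter> {..<k}" "(?T - {l}) \<inter> {k<..} = D \<inter> {k<..} - {l}"
          using l(2) by auto
        ultimately have "nths js (?T - {l}) = (?A @ [?j]) @ ks @ ls"
          using nths_split_at[OF k(1), of "?T - {l}"] l(2) by simp
        then have "?d (?T - {l}) = w"
          using idle(2) nT dT by simp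
        then show ?thesis
          using the_l[OF l(1)] l(2) by simp
      qed
      then show ?thesis using False by blast
    qed
  qed
  show ?thesis
    unfolding absorbable_def absorbed_def positions_def Let_def nths_map demazure_letters_def[symmetric] length_map dD
    using main by blast
qed

text \<open>
  All reduced subwords that represent \<open>w\<close> have the same size, so none contains another.
\<close>

lemma facets_subword_complex:
  "facets (subword_complex N (map adj js) w) =
     (\<lambda>D. positions (map adj js) - D) ` {D. D \<subseteq> {..<length js} \<and> represents N (map adj js) D w}"
proof (intro equalityI subsetI)
  let ?Q = "map adj js"
  let ?C = "subword_complex N ?Q w"
  {
    fix F assume F: "F \<in> facets ?C"
    then obtain P where P: "F = positions ?Q - P" "P \<subseteq> positions ?Q" "contains_perm N ?Q P w"
      by (auto simp: facets_def subword_complex_def)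
    then obtain R where R: "R \<subseteq> P" "represents N ?Q R w"
      by (auto simp: contains_perm_def)
    have "positions ?Q - R \<in> ?C"
      using R P by (auto simp: subword_complex_def contains_perm_def)
    moreover have "F \<subseteq> positions ?Q - R" using P R by auto
    ultimately have "F = positions ?Q - R"
      using F by (auto simp: facets_def)
    then show "F \<in> (\<lambda>D. positions ?Q - D) ` {D. D \<subseteq> {..<length js} \<and> represents N ?Q D w}"
      using R P by (auto simp: positions_def)
  next
    fix F assume "F \<in> (\<lambda>D. positions ?Q - D) ` {D. D \<subseteq> {..<length js} \<and> represents N ?Q D w}"
    then obtain D where D: "F = positions ?Q - D" "D \<subseteq> {..<length js}" "represents N ?Q D w"
      by blast
    have "F \<in> ?C"
      using D by (auto simp: subword_complex_def contains_perm_def positions_def)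
    moreover have "G = F" if G: "G \<in> ?C" "F \<subseteq> G" for G
    proof -
      obtain P where P: "G = positions ?Q - P" "P \<subseteq> positions ?Q" "contains_perm N ?Q P w"
        using G by (auto simp: subword_complex_def)
      then obtain R where R: "R \<subseteq> P" "represents N ?Q R w"
        by (auto simp: contains_perm_def)
      have "P \<subseteq> D" using G(2) P D by (auto simp: positions_def)
      have "R \<subseteq> {..<length js}" using R P by (auto simp: positions_def)
      then have "card R = card D"
        using R(2) D(2,3) length_nths_card[of R ?Q] length_nths_card[of D ?Q]
        by (simp add: represents_def)
      then have "R = D"
        using R(1) \<open>P \<subseteq> D\<close> D(2) by (meson card_subset_eq finite_lessThan finite_subset subset_trans)
      then show "G = F" using R(1) \<open>P \<subseteq> D\<close> P(1) D(1) by auto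
    qed
    ultimately show "F \<in> facets ?C" by (auto simp: facets_def)
  }
qed

section \<open>The 0-Hecke algebra and the sum over reduced subwords\<close>

text \<open>
  Functions on permutations stand for formal linear combinations, \<open>f v\<close> being the coefficient of \<open>v\<close>. The
  operator is right multiplication by \<open>a + (a - b) u\<^sub>j\<close>, where \<open>\<tau> u\<^sub>j = \<tau> s\<^sub>j\<close> if \<open>\<tau>\<close> has an ascent at \<open>j\<close> and
  \<open>\<tau> u\<^sub>j = - \<tau>\<close> if it has a descent. The two parameters are a homogeneous form of \<open>1 + (1 - b / a) u\<^sub>j\<close> that
  needs no division.
\<close>

definition hecke_op :: "nat \<Rightarrow> 'r \<Rightarrow> 'r \<Rightarrow> ((nat \<Rightarrow> nat) \<Rightarrow> 'r) \<Rightarrow> (nat \<Rightarrow> nat) \<Rightarrow> 'r::comm_ring_1" where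
  "hecke_op j a b f v = (if v (Suc j) < v j then b * f v + (a - b) * f (v \<circ> adj j) else a * f v)"

abbreviation hecke_factor :: "nat \<Rightarrow> 'r \<Rightarrow> ((nat \<Rightarrow> nat) \<Rightarrow> 'r) \<Rightarrow> (nat \<Rightarrow> nat) \<Rightarrow> 'r::comm_ring_1" where
  "hecke_factor j p \<equiv> hecke_op j 1 p"

text \<open>
  The first entry of the list is applied first, so this is right multiplication by the product of the
  factors in the order of the word.
\<close>

definition hecke_transfer :: "(nat \<times> 'r) list \<Rightarrow> ((nat \<Rightarrow> nat) \<Rightarrow> 'r) \<Rightarrow> (nat \<Rightarrow> nat) \<Rightarrow> 'r::comm_ring_1" where
  "hecke_transfer xs = fold (\<lambda>(j, p). hecke_factor j p) xs"

definition unit_vec :: "(nat \<Rightarrow> nat) \<Rightarrow> 'r::comm_ring_1" where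
  "unit_vec v = (if v = id then 1 else 0)"

lemma transfer_simps [simp]:
  "hecke_transfer [] f = f"
  "hecke_transfer ((j, p) # xs) f = hecke_transfer xs (hecke_factor j p f)"
  "hecke_transfer (xs @ ys) f = hecke_transfer ys (hecke_transfer xs f)"
  by (simp_all add: hecke_transfer_def)

definition reduced_subwords :: "nat \<Rightarrow> nat list \<Rightarrow> (nat \<Rightarrow> nat) \<Rightarrow> nat set set" where
  "reduced_subwords N js w = {D. D \<subseteq> {..<length js} \<and> represents N (map adj js) D w}"

lemma finite_reduced_subwords: "finite (reduced_subwords N js w)"
  by (rule finite_subset[of _ "Pow {..<length js}"]) (auto simp: reduced_subwords_def)

lemma nths_snoc_out: "D \<subseteq> {..<length js} \<Longrightarrow> nths (js @ [j]) D = nths js D"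
  by (auto simp: nths_append)

lemma nths_snoc_in:
  assumes "D \<subseteq> {..<length js}"
  shows "nths (js @ [j]) (insert (length js) D) = nths js D @ [j]"
proof -
  have "insert (length js) D \<inter> {..<length js} = D" "insert (length js) D \<inter> {length js<..} = {}"
    using assms by auto
  then show ?thesis
    using nths_split_at[of "length js" "js @ [j]" "insert (length js) D"] nths_snoc_out[OF assms]
    by simp
qed

text \<open>
  A representing subword either avoids the last letter, or it arises from one for \<open>w s\<^sub>j\<close> by adding that
  letter; the latter requires \<open>w s\<^sub>j\<close> to be shorter than \<open>w\<close>.
\<close>

lemma reduced_subwords_snoc:
  assumes letters: "set (js @ [j]) \<subseteq> {1..<N}" and w: "w permutes {1..N}"
  shows "reduced_subwords N (js @ [j]) w = reduced_subwords N js w \<union>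
    (if w (Suc j) < w j then insert (length js) ` reduced_subwords N js (w \<circ> adj j) else {})"
    (is "?L = ?R")
proof -
  let ?m = "length js"
  have ins: "insert ?m D \<in> ?L \<longleftrightarrow> D \<in> reduced_subwords N js (w \<circ> adj j) \<and> w (Suc j) < w j"
    if D: "D \<subseteq> {..<?m}" for D
  proof -
    have set: "set (nths js D @ [j]) \<subseteq> {1..<N}"
      using letters set_nths_letters[of js N D] by simp
    have "letters_prod (nths js D) = w \<circ> adj j \<and> w (Suc j) < w j \<longleftrightarrow>
        letters_prod (nths js D @ [j]) = w \<and> letters_prod (nths js D) j < letters_prod (nths js D) (Suc j)"
      by auto
    then show ?thesis
      using D reduced_snoc_iff[OF set] nths_snoc_in[OF D, of j]
      by (auto simp: reduced_subwords_def represents_iff[of N "js @ [j]", simplified] represents_iff)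
  qed
  have out: "D \<in> ?L \<longleftrightarrow> D \<in> reduced_subwords N js w" if D: "D \<subseteq> {..<?m}" for D
    using D nths_snoc_out[OF D, of j]
    by (auto simp: reduced_subwords_def represents_iff[of N "js @ [j]", simplified] represents_iff)
  have sub: "D \<subseteq> {..<?m}" if "D \<in> reduced_subwords N js v" for D v
    using that by (simp add: reduced_subwords_def)
  show ?thesis
  proof (intro equalityI subsetI)
    fix D assume D: "D \<in> ?L"
    then have le: "D \<subseteq> insert ?m {..<?m}"
      by (auto simp: reduced_subwords_def less_Suc_eq)
    show "D \<in> ?R"
    proof (cases "?m \<in> D")
      case True
      then have "insert ?m (D - {?m}) = D" "D - {?m} \<subseteq> {..<?m}" using le by auto
      then show ?thesis using ins[of "D - {?m}"] D by (auto simp del: insert_Diff_single)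
    next
      case False
      then have "D \<subseteq> {..<?m}" using le by auto
      then show ?thesis using out D by auto
    qed
  next
    fix D assume "D \<in> ?R"
    then show "D \<in> ?L"
      using ins out sub by (auto split: if_splits)
  qed
qed

lemma absorbed_snoc_in:
  assumes "D \<subseteq> {..<length js}"
  shows "absorbed (js @ [j]) (insert (length js) D) = absorbed js D"
proof -
  have "nths (js @ [j]) (insert (length js) D \<inter> {..<k}) = nths js (D \<inter> {..<k})"
    if "k < length js" for k
  proof -
    have "insert (length js) D \<inter> {..<k} = D \<inter> {..<k}" using that by auto
    then show ?thesis using assms by (simp add: nths_snoc_out le_infI1)
  qed
  then show ?thesis
    by (auto simp: absorbed_def less_Suc_eq nth_append)
qed

lemma absorbed_snoc_out:
  assumes "D \<subseteq> {..<length js}" "letters_prod (nths js D) = w"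
  shows "absorbed (js @ [j]) D = (if w (Suc j) < w j then insert (length js) (absorbed js D) else absorbed js D)"
proof -
  have "nths (js @ [j]) (D \<inter> {..<k}) = nths js (D \<inter> {..<k})" for k
    using assms by (simp add: nths_snoc_out le_infI1)
  moreover have "D \<inter> {..<length js} = D" using assms by auto
  ultimately show ?thesis
    using assms by (auto simp: absorbed_def less_Suc_eq nth_append)
qed

text \<open>
  Induction on the word from the right. At a descent \<open>j\<close> of \<open>w\<close>, the subwords that use the last letter
  contribute \<open>1 - p\<close> times the coefficient of \<open>w s\<^sub>j\<close>, and for the others the last position is absorbable and
  contributes \<open>p\<close>; at an ascent only the subwords avoiding the last letter exist, and it is not absorbable.
\<close>

lemma transfer_eq_sum_reduced_subwords:
  fixes xs :: "(nat \<times> 'r::comm_ring_1) list"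
  assumes "set (map fst xs) \<subseteq> {1..<N}" "w permutes {1..N}"
  shows "hecke_transfer xs unit_vec w = (\<Sum>D\<in>reduced_subwords N (map fst xs) w.
    (\<Prod>k\<in>D. 1 - snd (xs ! k)) * (\<Prod>k\<in>absorbed (map fst xs) D. snd (xs ! k)))"
  using assms
proof (induction xs arbitrary: w rule: rev_induct)
  case Nil
  have "reduced_subwords N [] w = (if w = id then {{}} else {})"
    using perm_length_le_length[of "[]" N]
    by (auto simp: reduced_subwords_def represents_iff[of N "[]", simplified] reduced_def id_def)
  then show ?case
    by (auto simp: unit_vec_def absorbed_def)
next
  case (snoc x xs)
  obtain j p where x: "x = (j, p)" by (cases x)
  let ?js = "map fst xs" and ?m = "length xs"
  define t where "t xs D = (\<Prod>k\<in>D. 1 - snd (xs ! k)) * (\<Prod>k\<in>absorbed (map fst xs) D. snd (xs ! k))"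
    for D and xs :: "(nat \<times> 'r) list"
  have letters: "set (?js @ [j]) \<subseteq> {1..<N}" using snoc.prems x by simp
  then have "w \<circ> adj j permutes {1..N}"
    using snoc.prems by (intro permutes_comp_adj) auto
  then have IH: "hecke_transfer xs unit_vec w = (\<Sum>D\<in>reduced_subwords N ?js w. t xs D)"
    "hecke_transfer xs unit_vec (w \<circ> adj j) = (\<Sum>D\<in>reduced_subwords N ?js (w \<circ> adj j). t xs D)"
    using snoc.IH snoc.prems letters unfolding t_def by simp_all
  have sub: "D \<subseteq> {..<?m}" "absorbed ?js D \<subseteq> {..<?m}" if "D \<in> reduced_subwords N ?js v" for D v
    using that by (auto simp: reduced_subwords_def absorbed_def)
  have fin: "finite D" if "D \<subseteq> {..<?m}" for D
    using that by (rule finite_subset) simp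
  have nth: "(\<Prod>k\<in>D. f (snd ((xs @ [x]) ! k))) = (\<Prod>k\<in>D. f (snd (xs ! k)))"
    if "D \<subseteq> {..<?m}" for D and f :: "'r \<Rightarrow> 'r"
    using that by (intro prod.cong) (auto simp: nth_append)
  note nth = nth[of _ "\<lambda>p. 1 - p"] nth[of _ "\<lambda>p. p"]
  have t_in: "t (xs @ [x]) (insert ?m D) = (1 - p) * t xs D" if D: "D \<in> reduced_subwords N ?js v" for D v
  proof -
    have "?m \<notin> D" using sub(1)[OF D] by auto
    then show ?thesis
      using sub[OF D] absorbed_snoc_in[of D ?js j] fin[OF sub(1)[OF D]] nth[OF sub(1)[OF D]]
        nth[OF sub(2)[OF D]]
      by (simp add: t_def x algebra_simps)
  qed
  have t_out: "t (xs @ [x]) D = (if w (Suc j) < w j then p else 1) * t xs D"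
    if D: "D \<in> reduced_subwords N ?js w" for D
  proof -
    have "letters_prod (nths ?js D) = w"
      using D represents_iff[of N ?js D w] by (simp add: reduced_subwords_def)
    moreover have "?m \<notin> absorbed ?js D" using sub(2)[OF D] by auto
    ultimately show ?thesis
      using sub[OF D] absorbed_snoc_out[of D ?js w j] fin[OF sub(2)[OF D]] nth[OF sub(1)[OF D]]
        nth[OF sub(2)[OF D]]
      by (simp add: t_def x algebra_simps)
  qed
  have sum_out: "(\<Sum>D\<in>reduced_subwords N ?js w. t (xs @ [x]) D)
      = (if w (Suc j) < w j then p else 1) * hecke_transfer xs unit_vec w"
    unfolding IH(1) sum_distrib_left using t_out by (intro sum.cong) auto
  have "inj_on (insert ?m) (reduced_subwords N ?js (w \<circ> adj j))"
    using sub by (intro inj_onI) (metis Diff_insert_absorb lessThan_iff less_irrefl subsetD)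
  then have sum_in: "(\<Sum>D\<in>insert ?m ` reduced_subwords N ?js (w \<circ> adj j). t (xs @ [x]) D)
      = (1 - p) * hecke_transfer xs unit_vec (w \<circ> adj j)"
    unfolding IH(2) sum_distrib_left using t_in by (subst sum.reindex) (auto intro!: sum.cong)
  have disj: "reduced_subwords N ?js w \<inter> insert ?m ` reduced_subwords N ?js (w \<circ> adj j) = {}"
    using sub by auto
  have "(\<Sum>D\<in>reduced_subwords N (map fst (xs @ [x])) w. t (xs @ [x]) D) = hecke_transfer (xs @ [x]) unit_vec w"
    using reduced_subwords_snoc[OF letters snoc.prems(2)] sum_out sum_in disj
    by (simp add: x hecke_op_def sum.union_disjoint finite_reduced_subwords)
  then show ?case by (simp add: t_def)
qed

section \<open>The Yang-Baxter equation and the interchange of two rows\<close>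

lemma hecke_op_commute:
  assumes "Suc j < k"
  shows "hecke_op j a b (hecke_op k c d f) = hecke_op k c d (hecke_op j a b f)"
  using assms by (rule_tac ext) (simp add: hecke_op_def adj_commute[OF assms] algebra_simps)

text \<open>
  With \<open>h\<^sub>i(p) = 1 + (1 - p) u\<^sub>i\<close> this is the equation
  \<open>h\<^sub>i(p) h\<^bsub>i+1\<^esub>(p q) h\<^sub>i(q) = h\<^bsub>i+1\<^esub>(q) h\<^sub>i(p q) h\<^bsub>i+1\<^esub>(p)\<close> for \<open>p = a y\<close> and \<open>q = b / a\<close>, multiplied by \<open>a\<close>. It is verified
  on the coefficient at \<open>v\<close>, for each relative order of \<open>v i\<close>, \<open>v (i + 1)\<close> and \<open>v (i + 2)\<close>.
\<close>

lemma hecke_op_yang_baxter: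
  "hecke_op i a b (hecke_factor (Suc i) (b * y) (hecke_factor i (a * y) f))
   = hecke_factor (Suc i) (a * y) (hecke_factor i (b * y) (hecke_op (Suc i) a b f))"
proof
  fix v
  show "hecke_op i a b (hecke_factor (Suc i) (b * y) (hecke_factor i (a * y) f)) v
   = hecke_factor (Suc i) (a * y) (hecke_factor i (b * y) (hecke_op (Suc i) a b f)) v"
    using adj_braid[of v i]
    apply (cases "v (Suc i) < v i"; cases "v (Suc (Suc i)) < v (Suc i)"; cases "v (Suc (Suc i)) < v i")
    apply (simp_all add: hecke_op_def)
    apply (simp_all add: algebra_simps)
    done
qed

lemma upt_split: "i \<le> j \<Longrightarrow> j \<le> k \<Longrightarrow> [i..<k] = [i..<j] @ [j..<k]"
  by (metis upt_add_eq_append le_add_diff_inverse)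

lemma transfer_hecke_op_commute:
  assumes "\<And>j p. (j, p) \<in> set xs \<Longrightarrow> Suc j < k \<or> Suc k < j"
  shows "hecke_transfer xs (hecke_op k a b f) = hecke_op k a b (hecke_transfer xs f)"
  using assms
proof (induction xs arbitrary: f)
  case (Cons x xs)
  obtain j p where x: "x = (j, p)" by (cases x)
  have "hecke_factor j p (hecke_op k a b f) = hecke_op k a b (hecke_factor j p f)"
    using Cons.prems[of j p] hecke_op_commute[of j k 1 p a b f] hecke_op_commute[of k j a b 1 p f] x
    by auto
  moreover have "hecke_transfer xs (hecke_op k a b g) = hecke_op k a b (hecke_transfer xs g)" for g
    by (rule Cons.IH) (use Cons.prems in auto)
  ultimately show ?case
    using x by simp
qed simp

text \<open>
  Only the columns up to \<open>m\<close>, so that statements about full rows can be proved by induction on \<open>m\<close>.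
\<close>

definition row :: "nat \<Rightarrow> 'r \<Rightarrow> (nat \<Rightarrow> 'r) \<Rightarrow> nat \<Rightarrow> (nat \<times> 'r::comm_ring_1) list" where
  "row i a c m = map (\<lambda>j. (i + j - 1, a * c j)) (rev [1..<Suc m])"

lemma row_0: "row i a c 0 = []"
  by (simp add: row_def)

lemma row_Suc: "row i a c (Suc m) = (i + m, a * c (Suc m)) # row i a c m"
  by (simp add: row_def)

lemma row_letters: "(j, p) \<in> set (row i a c m) \<Longrightarrow> i \<le> j \<and> j < i + m"
  by (auto simp: row_def)

text \<open>
  The letters of column \<open>m\<close> in the two rows are \<open>s\<^bsub>i+m-1\<^esub>\<close> and \<open>s\<^bsub>i+m\<^esub>\<close>. The latter commutes with the letters of the
  upper row to its right, so the two rows can be multiplied column by column, and the Yang-Baxter equation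
  carries the extra factor through one column at a time.
\<close>

lemma transfer_two_rows:
  "hecke_op i a b (hecke_transfer (row i a c m @ row (Suc i) b c m) f)
   = hecke_transfer (row i b c m @ row (Suc i) a c m) (hecke_op (i + m) a b f)"
proof (induction m arbitrary: f)
  case 0
  then show ?case by (simp add: row_0)
next
  case (Suc m)
  have interleave: "hecke_transfer (row i a c (Suc m) @ row (Suc i) b c (Suc m)) f
      = hecke_transfer (row i a c m @ row (Suc i) b c m)
          (hecke_factor (Suc (i + m)) (b * c (Suc m)) (hecke_factor (i + m) (a * c (Suc m)) f))" for a b f
    using transfer_hecke_op_commute[of "row i a c m" "Suc (i + m)" 1 "b * c (Suc m)"] row_letters[of _ _ i a c m]
    by (fastforce simp: row_Suc)
  show ?case
    unfolding interleave Suc.IH by (simp add: hecke_op_yang_baxter)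
qed

definition rows :: "(nat \<Rightarrow> 'r) \<Rightarrow> (nat \<Rightarrow> 'r) \<Rightarrow> nat \<Rightarrow> (nat \<times> 'r::comm_ring_1) list" where
  "rows x c n = map (\<lambda>(i, j). (i + j - 1, x i * c j)) (grid n)"

lemma rows_eq_concat: "rows x c n = concat (map (\<lambda>i. row i (x i) c n) [1..<Suc n])"
  by (simp add: rows_def grid_def row_def map_concat comp_def rev_map)

text \<open>
  The rows below row \<open>i + 1\<close> have letters beyond \<open>s\<^bsub>i+1\<^esub>\<close>, and those above row \<open>i\<close> have letters before \<open>s\<^bsub>i+n-1\<^esub>\<close>;
  so the extra factor commutes with them on entering and on leaving rows \<open>i\<close> and \<open>i + 1\<close>.
\<close>

lemma transfer_rows_swap:
  assumes i: "i \<in> {1..<n}"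
  shows "hecke_op i (x i) (x (Suc i)) (hecke_transfer (rows x c n) f)
    = hecke_transfer (rows (x \<circ> adj i) c n) (hecke_op (i + n) (x i) (x (Suc i)) f)"
proof -
  define block where "block x is = concat (map (\<lambda>i. row i (x i) c n) is)" for x :: "nat \<Rightarrow> 'a" and "is"
  let ?y = "x \<circ> adj i"
  have upt: "[1..<Suc n] = [1..<i] @ [i, Suc i] @ [Suc (Suc i)..<Suc n]"
    using i upt_split[of 1 i "Suc n"] by (simp add: upt_conv_Cons)
  have split: "rows x c n = block x [1..<i] @ (row i (x i) c n @ row (Suc i) (x (Suc i)) c n) @
      block x [Suc (Suc i)..<Suc n]" for x
    unfolding rows_eq_concat upt block_def by simp
  have same: "block ?y [1..<i] = block x [1..<i]"
    "block ?y [Suc (Suc i)..<Suc n] = block x [Suc (Suc i)..<Suc n]"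
    unfolding block_def by (auto intro!: arg_cong[of _ _ concat])
  have block_letters: "\<exists>i\<in>set is. i \<le> j \<and> j < i + n" if "(j, p) \<in> set (block x is)" for j p "is"
    using that row_letters by (fastforce simp: block_def)
  have top: "hecke_transfer (block x [1..<i]) (hecke_op (i + n) a b g)
      = hecke_op (i + n) a b (hecke_transfer (block x [1..<i]) g)" for a b g
    by (rule transfer_hecke_op_commute) (use block_letters in fastforce)
  have bot: "hecke_transfer (block x [Suc (Suc i)..<Suc n]) (hecke_op i a b g)
      = hecke_op i a b (hecke_transfer (block x [Suc (Suc i)..<Suc n]) g)" for a b g
    by (rule transfer_hecke_op_commute) (use block_letters in fastforce)
  show ?thesis
    unfolding split same transfer_simps(3) bot[symmetric] top
    using transfer_two_rows[of i "x i" "x (Suc i)" c n] by simp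
qed

lemma permutes_descent_in_range:
  assumes v: "v permutes {1..n}" and d: "v (Suc j) < v j"
  shows "j \<in> {1..<n}"
proof (rule ccontr)
  assume "j \<notin> {1..<n}"
  then consider "j = 0" | "n \<le> j" by fastforce
  then show False
  proof cases
    case 1
    then have "v j = 0" using permutes_not_in[OF v, of j] by simp
    then show False using d by simp
  next
    case 2
    then have "v (Suc j) = Suc j" using permutes_not_in[OF v, of "Suc j"] by simp
    moreover have "v j \<le> j"
      using permutes_not_in[OF v, of j] permutes_in_image[OF v, of j] 2
      by (cases "j \<in> {1..n}") auto
    ultimately show False using d by simp
  qed
qed

lemma permutes_comp_adj_descent:
  "v permutes {1..n} \<Longrightarrow> v (Suc j) < v j \<Longrightarrow> v \<circ> adj j permutes {1..n}"
  using permutes_descent_in_range permutes_comp_adj by blast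

text \<open>
  Coefficients at elements of \<open>S\<^sub>n\<close> depend only on coefficients at elements of \<open>S\<^sub>n\<close>, because the descents of
  such an element are less than \<open>n\<close>.
\<close>

lemma transfer_cong:
  assumes "\<And>v. v permutes {1..n} \<Longrightarrow> f v = g v" "v permutes {1..n}"
  shows "hecke_transfer xs f v = hecke_transfer xs g v"
  using assms
proof (induction xs arbitrary: v rule: rev_induct)
  case (snoc x xs)
  then show ?case
    using permutes_comp_adj_descent[OF snoc.prems(2)] by (cases x) (simp add: hecke_op_def)
qed simp

text \<open>
  An element of \<open>S\<^sub>n\<close> has no descent at \<open>j \<ge> n\<close>, so the letter \<open>s\<^sub>j\<close> leaves its coefficient unchanged.
\<close>

lemma transfer_filter_letters:
  assumes "v permutes {1..n}"
  shows "hecke_transfer xs f v = hecke_transfer (filter (\<lambda>(j, p). j < n) xs) f v"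
  using assms
proof (induction xs arbitrary: v rule: rev_induct)
  case (snoc x xs)
  obtain j p where x: "x = (j, p)" by (cases x)
  show ?case
    using snoc.IH snoc.prems permutes_comp_adj_descent[OF snoc.prems, of j]
      permutes_descent_in_range[OF snoc.prems, of j]
    by (auto simp: x hecke_op_def o_def)
qed simp

lemma transfer_scale: "hecke_transfer xs (\<lambda>v. a * f v) v = a * hecke_transfer xs f v"
proof (induction xs arbitrary: v rule: rev_induct)
  case (snoc x xs)
  then show ?case by (cases x) (simp add: hecke_op_def o_def algebra_simps)
qed simp

text \<open>
  The factor that emerges on the left belongs to \<open>s\<^bsub>i+n\<^esub>\<close>, at which no element of \<open>S\<^sub>n\<close> has a descent, so it
  acts on the relevant coefficients as a scalar.
\<close>

lemma transfer_rows_exchange: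
  assumes i: "i \<in> {1..<n}" and v: "v permutes {1..n}"
  shows "hecke_op i (x i) (x (Suc i)) (hecke_transfer (rows x c n) unit_vec) v
    = x i * hecke_transfer (rows (x \<circ> adj i) c n) unit_vec v"
proof -
  have outside: "hecke_op (i + n) (x i) (x (Suc i)) unit_vec u = x i * unit_vec u" if "u permutes {1..n}" for u
    using permutes_descent_in_range[OF that, of "i + n"] by (auto simp: hecke_op_def)
  show ?thesis
    unfolding transfer_rows_swap[OF i] transfer_scale[symmetric]
    by (intro transfer_cong[OF _ v] outside)
qed

section \<open>The coefficient at the longest permutation\<close>

text \<open>
  The whole word is its only subword with that product and of that length.
\<close>

lemma transfer_reduced_word:
  fixes xs :: "(nat \<times> 'r::comm_ring_1) list"
  assumes letters: "set (map fst xs) \<subseteq> {1..<N}" and red: "reduced N (map fst xs)"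
  shows "hecke_transfer xs unit_vec (letters_prod (map fst xs)) = (\<Prod>k<length xs. 1 - snd (xs ! k))"
proof -
  let ?js = "map fst xs" and ?w = "letters_prod (map fst xs)"
  have "D \<in> reduced_subwords N ?js ?w \<longleftrightarrow> D = {..<length xs}" for D
  proof
    assume "D \<in> reduced_subwords N ?js ?w"
    then have "D \<subseteq> {..<length xs}" "length (nths ?js D) = length xs"
      using red by (auto simp: reduced_subwords_def represents_iff[of N ?js, simplified] reduced_def)
    then show "D = {..<length xs}"
      using length_nths_card[of D ?js] by (simp add: card_subset_eq)
  next
    assume D: "D = {..<length xs}"
    have "nths ?js D = ?js" by (rule nths_all) (simp add: D)
    then show "D \<in> reduced_subwords N ?js ?w"
      using red D represents_iff[of N ?js D ?w] by (simp add: reduced_subwords_def)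
  qed
  then have "reduced_subwords N ?js ?w = {{..<length xs}}" by blast
  moreover have "absorbed ?js {..<length xs} = {}" by (auto simp: absorbed_def)
  ultimately show ?thesis
    using transfer_eq_sum_reduced_subwords[OF letters letters_prod_permutes[OF letters]] by simp
qed

lemma letters_prod_cycle:
  "i \<le> n \<Longrightarrow> letters_prod (rev [i..<n]) a = (if a = i then n else if i < a \<and> a \<le> n then a - 1 else a)"
proof (induction n arbitrary: a rule: dec_induct)
  case (step n)
  then show ?case by (auto simp: adj_def transpose_def)
qed simp

text \<open>
  Row \<open>i\<close> of the staircase is the cycle that sends \<open>i\<close> to \<open>n\<close> and lowers \<open>i + 1, \<dots>, n\<close> by one; the first \<open>k\<close>
  rows reverse the entries up to \<open>k\<close> and lower the others by \<open>k\<close>.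
\<close>

lemma letters_prod_staircase:
  "k \<le> n \<Longrightarrow> letters_prod (concat (map (\<lambda>i. rev [i..<n]) [1..<Suc k])) a
     = (if 1 \<le> a \<and> a \<le> k then Suc n - a else if k < a \<and> a \<le> n then a - k else a)"
proof (induction k arbitrary: a)
  case (Suc k)
  have "letters_prod (concat (map (\<lambda>i. rev [i..<n]) [1..<Suc (Suc k)])) a
      = letters_prod (concat (map (\<lambda>i. rev [i..<n]) [1..<Suc k])) (letters_prod (rev [Suc k..<n]) a)"
    by simp
  also have "\<dots> = (if 1 \<le> a \<and> a \<le> Suc k then Suc n - a else if Suc k < a \<and> a \<le> n then a - Suc k else a)"
    unfolding letters_prod_cycle[OF Suc.prems] using Suc by (subst Suc.IH) auto
  finally show ?case .
qed simp

definition staircase :: "nat \<Rightarrow> (nat \<times> nat) list" where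
  "staircase n = filter (\<lambda>(i, j). i + j \<le> n) (grid n)"

lemma set_grid: "set (grid n) = {1..n} \<times> {1..n}"
  by (auto simp: grid_def image_iff simp del: upt_Suc)

lemma distinct_grid: "distinct (grid n)"
proof -
  have "grid n = concat (map (\<lambda>i. map (Pair i) (rev [1..<Suc n])) [1..<Suc n])"
    by (simp add: grid_def)
  also have "distinct \<dots>"
    by (rule distinct_concat) (auto simp: distinct_map inj_on_def)
  finally show ?thesis .
qed

lemma set_staircase: "set (staircase n) = {(i, j). 1 \<le> i \<and> 1 \<le> j \<and> i + j \<le> n}"
  by (auto simp: staircase_def set_grid)

lemma distinct_staircase: "distinct (staircase n)"
  by (simp add: staircase_def distinct_grid)

lemma staircase_letters:
  "map (\<lambda>(i, j). i + j - 1) (staircase n) = concat (map (\<lambda>i. rev [i..<n]) [1..<Suc n])"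
proof -
  have "map (\<lambda>j. i + j - 1) (filter (\<lambda>j. i + j \<le> n) (rev [1..<Suc n])) = rev [i..<n]"
    if "i \<in> set [1..<Suc n]" for i
  proof -
    have "[1..<Suc n] = [1..<Suc (n - i)] @ [Suc (n - i)..<Suc n]"
      using upt_split[of 1 "Suc (n - i)" "Suc n"] by simp
    moreover have "filter (\<lambda>j. i + j \<le> n) [1..<Suc (n - i)] = [1..<Suc (n - i)]"
      by (rule filter_True) (use that in auto)
    moreover have "filter (\<lambda>j. i + j \<le> n) [Suc (n - i)..<Suc n] = []"
      by (rule filter_False) auto
    ultimately have "filter (\<lambda>j. i + j \<le> n) [1..<Suc n] = [1..<Suc (n - i)]"
      by (simp only: filter_append append_Nil2)
    moreover have "map (\<lambda>j. i + j - 1) [1..<Suc (n - i)] = [i..<n]"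
      using that by (intro nth_equalityI) (auto simp del: upt_Suc)
    ultimately show ?thesis
      by (simp only: rev_filter[symmetric] rev_map[symmetric])
  qed
  then have "concat (map (\<lambda>i. map (\<lambda>j. i + j - 1) (filter (\<lambda>j. i + j \<le> n) (rev [1..<Suc n]))) [1..<Suc n])
      = concat (map (\<lambda>i. rev [i..<n]) [1..<Suc n])"
    by (intro arg_cong[of _ _ concat] map_cong refl)
  moreover have "staircase n
      = concat (map (\<lambda>i. map (Pair i) (filter (\<lambda>j. i + j \<le> n) (rev [1..<Suc n]))) [1..<Suc n])"
    unfolding staircase_def grid_def
    by (simp add: filter_concat filter_map comp_def del: upt_Suc)
  ultimately show ?thesis
    by (simp add: map_concat comp_def del: upt_Suc)
qed

lemma letters_prod_staircase_eq_reversal: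
  "letters_prod (map (\<lambda>(i, j). i + j - 1) (staircase n)) = reversal n"
  unfolding staircase_letters
  by (rule ext, subst letters_prod_staircase) (auto simp: reversal_def)

lemma staircase_letters_range: "set (map (\<lambda>(i, j). i + j - 1) (staircase n)) \<subseteq> {1..<n}"
  by (auto simp: set_staircase)

text \<open>
  Cells \<open>(i, j)\<close> of the staircase correspond to inversions \<open>(i, i + j)\<close> of the reversal.
\<close>

lemma staircase_reduced: "reduced n (map (\<lambda>(i, j). i + j - 1) (staircase n))"
proof -
  let ?S = "{(i, j). 1 \<le> i \<and> 1 \<le> j \<and> i + j \<le> n}"
  have "inversions n (reversal n) = (\<lambda>(i, j). (i, i + j)) ` ?S"
  proof (intro equalityI subsetI)
    fix p assume "p \<in> inversions n (reversal n)"
    then show "p \<in> (\<lambda>(i, j). (i, i + j)) ` ?S"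
      by (intro image_eqI[of _ _ "(fst p, snd p - fst p)"]) (auto simp: inversions_def)
  qed (auto simp: inversions_def reversal_def)
  moreover have "inj_on (\<lambda>(i, j). (i, i + j)) ?S" by (auto simp: inj_on_def)
  ultimately have "card (inversions n (reversal n)) = length (staircase n)"
    using distinct_card[OF distinct_staircase[of n]] by (simp add: card_image set_staircase)
  then show ?thesis
    using perm_length_eq_card_inversions[OF letters_prod_permutes[OF staircase_letters_range]]
    unfolding reduced_def letters_prod_staircase_eq_reversal by simp
qed

lemma reversal_permutes: "reversal n permutes {1..n}"
  using letters_prod_permutes[OF staircase_letters_range[of n]]
  unfolding letters_prod_staircase_eq_reversal .

lemma transfer_rows_reversal:
  "hecke_transfer (rows x c n) unit_vec (reversal n)
    = (\<Prod>(i, j)\<in>{(i, j). 1 \<le> i \<and> 1 \<le> j \<and> i + j \<le> n}. 1 - x i * c j)"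
proof -
  let ?f = "\<lambda>(i, j). (i + j - 1, x i * c j)"
  let ?xs = "map ?f (staircase n)"
  have "filter (\<lambda>(j, p). j < n) (rows x c n) = ?xs"
    unfolding rows_def staircase_def filter_map
    by (intro arg_cong[of _ _ "map ?f"] filter_cong refl) (auto simp: set_grid)
  then have "hecke_transfer (rows x c n) unit_vec (reversal n) = hecke_transfer ?xs unit_vec (reversal n)"
    using transfer_filter_letters[OF reversal_permutes] by metis
  also have "\<dots> = (\<Prod>k<length ?xs. 1 - snd (?xs ! k))"
  proof -
    have fst: "map fst ?xs = map (\<lambda>(i, j). i + j - 1) (staircase n)"
      by (simp add: case_prod_unfold)
    show ?thesis
      by (rule transfer_reduced_word[of ?xs n, unfolded fst letters_prod_staircase_eq_reversal,
            OF staircase_letters_range staircase_reduced])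
  qed
  also have "\<dots> = (\<Prod>(i, j)\<in>set (staircase n). 1 - x i * c j)"
    by (rule prod.reindex_bij_betw[of "(!) (staircase n)" "{..<length ?xs}", THEN trans[rotated]])
      (auto simp: case_prod_unfold intro!: bij_betw_nth distinct_staircase)
  finally show ?thesis by (simp only: set_staircase)
qed

section \<open>Grothendieck polynomials\<close>

lemma permute_vars_transfer:
  assumes "bij \<pi>"
  shows "permute_vars \<pi> (hecke_transfer xs f v)
    = hecke_transfer (map (\<lambda>(j, p). (j, permute_vars \<pi> p)) xs) (\<lambda>u. permute_vars \<pi> (f u)) v"
proof (induction xs arbitrary: v rule: rev_induct)
  case (snoc x xs)
  then show ?case
    by (cases x) (simp add: hecke_op_def o_def permute_vars_add permute_vars_mult permute_vars_diff
        permute_vars_one assms)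
qed simp

text \<open>
  A common form of the two kinds of polynomials: the second variables are replaced by arbitrary
  constants \<open>c j\<close> of the coefficient ring.
\<close>

definition groth_poly :: "nat \<Rightarrow> (nat \<Rightarrow> 'a) \<Rightarrow> (nat \<Rightarrow> nat) \<Rightarrow> 'a::comm_ring_1 mpoly" where
  "groth_poly n c w = hecke_transfer (rows X (\<lambda>j. Poly_Mapping.single 0 (c j)) n) unit_vec w"

lemma permute_vars_groth_poly:
  assumes "bij \<pi>"
  shows "permute_vars \<pi> (groth_poly n c w)
    = hecke_transfer (rows (X \<circ> \<pi>) (\<lambda>j. Poly_Mapping.single 0 (c j)) n) unit_vec w"
proof -
  have "(\<lambda>u. permute_vars \<pi> (unit_vec u)) = (unit_vec :: _ \<Rightarrow> 'a mpoly)"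
    by (auto simp: unit_vec_def permute_vars_one permute_vars_zero assms)
  then show ?thesis
    unfolding groth_poly_def permute_vars_transfer[OF assms] rows_def
    by (simp add: comp_def case_prod_unfold permute_vars_mult permute_vars_coeff permute_vars_X assms)
qed

lemma demazure_op_groth_poly:
  fixes c :: "nat \<Rightarrow> 'a::idom"
  assumes w: "w permutes {1..n}" and i: "i \<in> {1..<n}" and d: "w (Suc i) < w i"
  shows "demazure_op i (groth_poly n c w) = groth_poly n c (w \<circ> adj i)"
proof (rule demazure_op_eqI)
  have "X (Suc i) * groth_poly n c w + (X i - X (Suc i)) * groth_poly n c (w \<circ> adj i)
      = X i * permute_vars (adj i) (groth_poly n c w)"
    using transfer_rows_exchange[OF i w, of X "\<lambda>j. Poly_Mapping.single 0 (c j)"] d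
    by (simp add: permute_vars_groth_poly[OF bij_adj] hecke_op_def flip: groth_poly_def)
  then show "(X (Suc i) - X i) * groth_poly n c (w \<circ> adj i)
      = X (Suc i) * groth_poly n c w - X i * permute_vars (adj i) (groth_poly n c w)"
    by (simp add: algebra_simps)
qed

text \<open>
  This yields uniqueness in the recurrence: the value at \<open>w\<close> does not depend on the chain of descents
  that leads from the longest permutation to \<open>w\<close>.
\<close>

lemma groth_rel_imp_groth_poly:
  fixes c :: "nat \<Rightarrow> 'a::idom"
  assumes "groth_rel n (groth_poly n c (reversal n)) w f"
  shows "w permutes {1..n} \<and> f = groth_poly n c w"
  using assms
proof induction
  case longest
  then show ?case by (simp add: longest_perm_eq_reversal reversal_permutes[unfolded One_nat_def])
next
  case (descend w f i)
  then show ?case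
    using perm_length_less_iff_descent[of w n i] demazure_op_groth_poly[of w n i c]
      permutes_comp_adj[of w n i] by (simp add: o_def)
qed

text \<open>
  As long as \<open>w\<close> has an ascent \<open>i\<close>, it is obtained from the longer permutation \<open>w s\<^sub>i\<close>; a permutation
  without ascents is the longest one.
\<close>

lemma groth_rel_exists:
  assumes "w permutes {1..n}"
  shows "\<exists>f. groth_rel n g0 w f"
  using assms
proof (induction "n * n - card (inversions n w)" arbitrary: w rule: less_induct)
  case less
  show ?case
  proof (cases "\<exists>i\<in>{1..<n}. w i < w (Suc i)")
    case True
    then obtain i where i: "i \<in> {1..<n}" "w i < w (Suc i)" by blast
    let ?w = "w \<circ> adj i"
    have w: "?w permutes {1..n}"
      using less.prems i(1) by (rule permutes_comp_adj)
    have "card (inversions n ?w) \<le> card ({1..n} \<times> {1..n})"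
      by (rule card_mono) (auto simp: inversions_def)
    then have "n * n - card (inversions n ?w) < n * n - card (inversions n w)"
      using card_inversions_ascent[OF i] by (simp add: card_cartesian_product)
    then obtain f where "groth_rel n g0 ?w f"
      using less.hyps w by blast
    moreover have "perm_length n (?w \<circ> adj i) < perm_length n ?w"
      using perm_length_less_iff_descent[OF w i(1)] i(2) by simp
    ultimately have "groth_rel n g0 (?w \<circ> adj i) (demazure_op i f)"
      using i(1) by (intro groth_rel.descend)
    then show ?thesis by auto
  next
    case False
    have "w (Suc i) < w i" if "i \<in> {1..<n}" for i
      using False that permutes_adj_neq[OF less.prems, of i] by (meson linorder_neqE_nat)
    then have "w = longest_perm n"
      unfolding longest_perm_eq_reversal by (rule no_ascent_imp_reversal[OF less.prems])
    then show ?thesis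
      using groth_rel.longest by blast
  qed
qed

lemma the_groth_rel:
  fixes c :: "nat \<Rightarrow> 'a::idom"
  assumes "w permutes {1..n}"
  shows "(THE f. groth_rel n (groth_poly n c (reversal n)) w f) = groth_poly n c w"
  using groth_rel_exists[OF assms] groth_rel_imp_groth_poly by (metis the_equality)

lemma groth_poly_reversal:
  "groth_poly n c (reversal n) = (\<Prod>(i, j)\<in>{(i, j). 1 \<le> i \<and> 1 \<le> j \<and> i + j \<le> n}.
     1 - X i * Poly_Mapping.single 0 (c j))"
  by (simp only: groth_poly_def transfer_rows_reversal)

lemma double_grothendieck_eq_groth_poly:
  "w permutes {1..n} \<Longrightarrow> double_grothendieck n w = groth_poly n X w"
  using the_groth_rel[of w n "X :: nat \<Rightarrow> int mpoly"]
  by (simp only: double_grothendieck_def groth_poly_reversal Y_def)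

lemma grothendieck_eq_groth_poly:
  assumes "w permutes {1..n}"
  shows "grothendieck n w = groth_poly n (\<lambda>_. 1) w"
proof -
  have "groth_poly n (\<lambda>_. 1 :: int) (reversal n)
      = (\<Prod>(i, j)\<in>(SIGMA i:{1..n}. {1..n - i}). 1 - X i)"
    unfolding groth_poly_reversal by (intro prod.cong) auto
  also have "\<dots> = (\<Prod>i=1..n. (1 - X i) ^ (n - i))"
    by (subst prod.Sigma[symmetric]) auto
  finally show ?thesis
    using the_groth_rel[OF assms, of "\<lambda>_. 1 :: int"] by (simp only: grothendieck_def)
qed

lemma groth_poly_eq_sum_facets:
  fixes c :: "nat \<Rightarrow> 'a::comm_ring_1"
  assumes w: "w permutes {1..n}"
  shows "groth_poly n c w = (\<Sum>F\<in>facets (square_complex n w).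
    let D = positions (square_word n) - F in
      (\<Prod>(i, j)\<in>cells n D. 1 - X i * Poly_Mapping.single 0 (c j)) *
      (\<Prod>(i, j)\<in>cells n (square_absorbable n D). X i * Poly_Mapping.single 0 (c j)))"
proof -
  let ?xs = "rows X (\<lambda>j. Poly_Mapping.single 0 (c j)) n"
  let ?js = "map (\<lambda>(i, j). i + j - 1) (grid n)"
  let ?p = "\<lambda>(i, j). X i * Poly_Mapping.single 0 (c j)"
  let ?pos = "positions (square_word n)"
  have js: "map fst ?xs = ?js"
    by (simp add: rows_def case_prod_unfold)
  have word: "square_word n = map adj ?js"
    by (simp add: square_word_def case_prod_unfold)
  have letters: "set ?js \<subseteq> {1..<2 * n}"
    by (auto simp: set_grid)
  have w2: "w permutes {1..2 * n}"
    using w by (rule permutes_subset) auto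
  have pos: "?pos = {..<length ?js}"
    by (simp add: word positions_def)
  have prod_cells: "prod f (cells n P) = (\<Prod>k\<in>P. f (grid n ! k))"
    if "P \<subseteq> {..<length ?js}" for P and f :: "_ \<Rightarrow> 'a mpoly"
  proof -
    have "inj_on ((!) (grid n)) P"
      using that by (intro inj_onI) (auto simp: nth_eq_iff_index_eq[OF distinct_grid] subset_iff)
    then show ?thesis
      unfolding cells_def by (simp add: prod.reindex)
  qed
  have snd: "snd (?xs ! k) = ?p (grid n ! k)" if "k < length ?js" for k
    using that by (simp add: rows_def case_prod_unfold)
  have "groth_poly n c w = (\<Sum>D\<in>reduced_subwords (2 * n) ?js w.
      (\<Prod>k\<in>D. 1 - snd (?xs ! k)) * (\<Prod>k\<in>absorbed ?js D. snd (?xs ! k)))"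
    unfolding groth_poly_def
    using transfer_eq_sum_reduced_subwords[of ?xs "2 * n" w] letters w2 unfolding js by blast
  also have "\<dots> = (\<Sum>D\<in>reduced_subwords (2 * n) ?js w.
      (\<Prod>x\<in>cells n D. 1 - ?p x) * (\<Prod>x\<in>cells n (square_absorbable n D). ?p x))"
  proof (intro sum.cong refl)
    fix D assume "D \<in> reduced_subwords (2 * n) ?js w"
    then have D: "D \<subseteq> {..<length ?js}" and "reduced (2 * n) (nths ?js D)"
      by (auto simp only: reduced_subwords_def represents_iff)
    then have "square_absorbable n D = absorbed ?js D"
      unfolding square_absorbable_def word by (intro absorbable_eq_absorbed letters)
    moreover have abs: "absorbed ?js D \<subseteq> {..<length ?js}"
      by (auto simp only: absorbed_def)
    moreover have "(\<Prod>k\<in>D. 1 - snd (?xs ! k)) = (\<Prod>k\<in>D. 1 - ?p (grid n ! k))"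
      using D by (intro prod.cong refl arg_cong[of _ _ "\<lambda>p. 1 - p"] snd) auto
    moreover have "(\<Prod>k\<in>absorbed ?js D. snd (?xs ! k)) = (\<Prod>k\<in>absorbed ?js D. ?p (grid n ! k))"
      using abs by (intro prod.cong refl snd) auto
    ultimately show "(\<Prod>k\<in>D. 1 - snd (?xs ! k)) * (\<Prod>k\<in>absorbed ?js D. snd (?xs ! k))
        = (\<Prod>x\<in>cells n D. 1 - ?p x) * (\<Prod>x\<in>cells n (square_absorbable n D). ?p x)"
      using prod_cells[OF D] prod_cells[OF abs] by simp
  qed
  also have "\<dots> = (\<Sum>D\<in>(\<lambda>D. ?pos - D) ` reduced_subwords (2 * n) ?js w.
      (\<Prod>x\<in>cells n (?pos - D). 1 - ?p x) * (\<Prod>x\<in>cells n (square_absorbable n (?pos - D)). ?p x))"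
  proof -
    have compl: "?pos - (?pos - D) = D" if "D \<in> reduced_subwords (2 * n) ?js w" for D
      using that by (auto simp only: reduced_subwords_def pos)
    then have inj: "inj_on (\<lambda>D. ?pos - D) (reduced_subwords (2 * n) ?js w)"
      by (rule inj_on_inverseI)
    show ?thesis
      unfolding sum.reindex[OF inj] comp_apply by (intro sum.cong refl) (simp only: compl)
  qed
  also have "(\<lambda>D. ?pos - D) ` reduced_subwords (2 * n) ?js w = facets (square_complex n w)"
    by (simp only: square_complex_def word facets_subword_complex reduced_subwords_def)
  finally show ?thesis
    by (simp only: Let_def case_prod_unfold)
qed

theorem corollary5p5:
  fixes n :: nat and w :: "nat \<Rightarrow> nat"
  assumes "w permutes {1..n}"
  shows "double_grothendieck n w =
           (\<Sum>F\<in>facets (square_complex n w).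
              let D = positions (square_word n) - F in
                (\<Prod>(i, j)\<in>cells n D. 1 - X i * Y j) *
                (\<Prod>(i, j)\<in>cells n (square_absorbable n D). X i * Y j))
       \<and> grothendieck n w =
           (\<Sum>F\<in>facets (square_complex n w).
              let D = positions (square_word n) - F in
                (\<Prod>(i, j)\<in>cells n D. 1 - X i) *
                (\<Prod>(i, j)\<in>cells n (square_absorbable n D). X i))"
  unfolding double_grothendieck_eq_groth_poly[OF assms] grothendieck_eq_groth_poly[OF assms]
    groth_poly_eq_sum_facets[OF assms] single_one mult_1_right Y_def
  by simp

end
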